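(* Let $R$ be a multiplicatively cancellative perfect semi-ring of characteristic one and let $\rho\in R^\times$ with $\rho\ge1$. Assume $\rho\neq1$. Then the ring $W(R,\rho)$ is an algebra over $\mathbb{R}$, with structure map $r:\mathbb{R}\to W(R,\rho)$ given by $$r(0)=0,\qquad r(s)=(\rho^{\log s},0)\ \text{ for } s>0,\qquad r(s)=(0,\rho^{\log|s|})\ \text{ for } s<0 .$$
   Context: Semi-rings are commutative, with $0$ and $1\ne0$. A semi-ring $R$ has characteristic one if $1+1=1$; its canonical partial order is $x\le y\iff x+y=y$. It is multiplicatively cancellative if $x\neq0$, $xy=xz$ imply $y=z$; then the maps $x\mapsto x^n$, $n\ge1$, are injective endomorphisms, and $R$ is perfect if they are all surjective. For $\alpha=a/b\in\mathbb{Q}_+^*$, $x^\alpha=\theta_\alpha(x)$ is the unique $z$ with $z^b=x^a$. For $\rho\in R^\times$, $\rho\ge1$, let $R_\rho=\{0\}\cup\bigcup_{n\in\mathbb{N}}\{x\in R:\rho^{-n}\le x\le\rho^n\}$, and for $x,y\in R_\rho\setminus\{0\}$ let $d(x,y)=\inf\{\alpha\in\mathbb{Q}_+^*: x\le y\rho^\alpha,\ y\le x\rho^\alpha\}$, a pseudo-metric. $\bar R_\rho$ is obtained by adjoining $0$ to the separated completion of $(R_\rho\setminus\{0\},d)$; the operations extend by continuity and $\bar R_\rho$ is again a perfect semi-ring of characteristic one, on which $\theta_\alpha$, $\alpha\in\mathbb{Q}_+^*$, extends by continuity to automorphisms $\theta_\lambda(x)=x^\lambda$, $\lambda\in\mathbb{R}_+^*$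 (so $\rho^\lambda$ makes sense for all $\lambda\in\mathbb{R}$, with $\rho^0=1$ and $\rho^{-\lambda}=(\rho^\lambda)^{-1}$). Let $S(\alpha)=-\alpha\log\alpha-(1-\alpha)\log(1-\alpha)$ on $[0,1]$ ($S(0)=S(1)=0$), and $w(\alpha)=\rho^{S(\alpha)}$. For $x,y\in\bar R_\rho$ put $$x+_wy=\sum_{\alpha\in\mathbb{Q}\cap[0,1]}w(\alpha)x^\alpha y^{1-\alpha}:=\lim_{n\to\infty}\ \sum_{\alpha\in\frac1n\mathbb{Z}\cap[0,1]}w(\alpha)x^\alpha y^{1-\alpha},$$ where $x^\alpha y^{1-\alpha}$ means $x$ for $\alpha=1$ and $y$ for $\alpha=0$. For $\rho\neq 1$, $(\bar R_\rho,+_w,\cdot)$ is a semi-ring. For a semi-ring $A$, the symmetrization $A^\Delta$ is the ring $(A\times A)/J$, where $A\times A$ has the operations $(a,b)+(c,d)=(a+c,b+d)$, $(a,b)(c,d)=(ac+bd,ad+bc)$, $J=\{(a,a):a\in A\}$, and $(a,b)\sim(a',b')$ iff there is $c\in A$ with $a+b'+c=a'+b+c$. Finally $W(R,\rho)=(\bar R_\rho,+_w,\cdot)^\Delta$. *)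

theory Defs
  imports Complex_Main "HOL-Algebra.Module" "HOL-Algebra.Algebraic_Closure_Type"
begin

section \<open>Semi-rings of characteristic one\<close>

text \<open>
  The semi-ring \<open>R\<close> is the type \<open>'a :: comm_semiring_1\<close> (commutative, \<open>0\<close> absorbing, \<open>0 \<noteq> 1\<close>).
  Characteristic one, cancellativity and perfectness are hypotheses of the theorem, not part of
  the definitions below.
\<close>

definition char_le :: "'a::comm_semiring_1 \<Rightarrow> 'a \<Rightarrow> bool"  (infix "\<preceq>" 50)
  where "x \<preceq> y \<longleftrightarrow> x + y = y"

definition unit_inv :: "'a::comm_semiring_1 \<Rightarrow> 'a"
  where "unit_inv u = (THE v. u * v = 1)"

text \<open>\<open>qpow \<alpha> x\<close> is \<open>\<theta>\<^sub>\<alpha>(x) = x\<^sup>\<alpha>\<close>, for rational \<open>\<alpha> > 0\<close>.  Requiring the equation for all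
  representations \<open>\<alpha> = a / b\<close> avoids choosing one.\<close>

definition qpow :: "rat \<Rightarrow> 'a::comm_semiring_1 \<Rightarrow> 'a"
  where "qpow \<alpha> x =
    (THE z. \<forall>a b. 0 < a \<and> 0 < b \<and> \<alpha> = of_nat a / of_nat b \<longrightarrow> z ^ b = x ^ a)"


section \<open>The bounded part and its separated completion\<close>

definition bounded_part :: "'a::comm_semiring_1 \<Rightarrow> 'a set"
  where "bounded_part \<rho> =
    insert 0 (\<Union>n::nat. {x. unit_inv \<rho> ^ n \<preceq> x \<and> x \<preceq> \<rho> ^ n})"

definition pdist :: "'a::comm_semiring_1 \<Rightarrow> 'a \<Rightarrow> 'a \<Rightarrow> real"
  where "pdist \<rho> x y =
    Inf {real_of_rat \<alpha> | \<alpha>. 0 < \<alpha> \<and> x \<preceq> y * qpow \<alpha> \<rho> \<and> y \<preceq> x * qpow \<alpha> \<rho>}"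

text \<open>The separated completion of the pseudo-metric space \<open>bounded_part \<rho> - {0}\<close>: Cauchy
  sequences modulo the relation of being at distance tending to \<open>0\<close>.\<close>

definition cauchy_seqs :: "'a::comm_semiring_1 \<Rightarrow> (nat \<Rightarrow> 'a) set"
  where "cauchy_seqs \<rho> =
    {s. (\<forall>n. s n \<in> bounded_part \<rho> - {0}) \<and>
        (\<forall>e>0. \<exists>N. \<forall>m\<ge>N. \<forall>n\<ge>N. pdist \<rho> (s m) (s n) < e)}"

definition cauchy_rel :: "'a::comm_semiring_1 \<Rightarrow> ((nat \<Rightarrow> 'a) \<times> (nat \<Rightarrow> 'a)) set"
  where "cauchy_rel \<rho> =
    {(s, t). s \<in> cauchy_seqs \<rho> \<and> t \<in> cauchy_seqs \<rho> \<and> (\<lambda>n. pdist \<rho> (s n) (t n)) \<longlonglongrightarrow> 0}"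

definition completion :: "'a::comm_semiring_1 \<Rightarrow> (nat \<Rightarrow> 'a) set set"
  where "completion \<rho> = cauchy_seqs \<rho> // cauchy_rel \<rho>"

definition cdist :: "'a::comm_semiring_1 \<Rightarrow> (nat \<Rightarrow> 'a) set \<Rightarrow> (nat \<Rightarrow> 'a) set \<Rightarrow> real"
  where "cdist \<rho> P Q =
    (THE \<delta>. \<forall>s\<in>P. \<forall>t\<in>Q. (\<lambda>n. pdist \<rho> (s n) (t n)) \<longlonglongrightarrow> \<delta>)"

text \<open>Extension by continuity to the completion of a unary or binary map on
  \<open>bounded_part \<rho> - {0}\<close>.\<close>

definition lift1 ::
    "'a::comm_semiring_1 \<Rightarrow> ('a \<Rightarrow> 'a) \<Rightarrow> (nat \<Rightarrow> 'a) set \<Rightarrow> (nat \<Rightarrow> 'a) set"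
  where "lift1 \<rho> f P = (\<Union>s\<in>P. cauchy_rel \<rho> `` {\<lambda>n. f (s n)})"

definition lift2 ::
    "'a::comm_semiring_1 \<Rightarrow> ('a \<Rightarrow> 'a \<Rightarrow> 'a) \<Rightarrow> (nat \<Rightarrow> 'a) set \<Rightarrow> (nat \<Rightarrow> 'a) set \<Rightarrow> (nat \<Rightarrow> 'a) set"
  where "lift2 \<rho> f P Q = (\<Union>s\<in>P. \<Union>t\<in>Q. cauchy_rel \<rho> `` {\<lambda>n. f (s n) (t n)})"


section \<open>The perfect semi-ring of characteristic one \<open>Rbar \<rho>\<close>\<close>

text \<open>\<open>None\<close> is the adjoined \<open>0\<close>.\<close>

type_synonym 'a compl0 = "(nat \<Rightarrow> 'a) set option"

definition of_R :: "'a::comm_semiring_1 \<Rightarrow> 'a \<Rightarrow> 'a compl0"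
  where "of_R \<rho> x = (if x = 0 then None else Some (cauchy_rel \<rho> `` {\<lambda>_. x}))"

definition Rbar :: "'a::comm_semiring_1 \<Rightarrow> 'a compl0 ring"
  where "Rbar \<rho> = \<lparr>
    carrier = insert None (Some ` completion \<rho>),
    monoid.mult = (\<lambda>x y. case (x, y) of
        (Some P, Some Q) \<Rightarrow> Some (lift2 \<rho> (*) P Q) | _ \<Rightarrow> None),
    one = of_R \<rho> 1,
    ring.zero = None,
    add = (\<lambda>x y. case (x, y) of
        (Some P, Some Q) \<Rightarrow> Some (lift2 \<rho> (+) P Q) | (None, _) \<Rightarrow> y | (_, None) \<Rightarrow> x)\<rparr>"

text \<open>Convergence of sequences in \<open>Rbar \<rho>\<close>; the adjoined \<open>0\<close> is an isolated point.\<close>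

definition converges_to :: "'a::comm_semiring_1 \<Rightarrow> (nat \<Rightarrow> 'a compl0) \<Rightarrow> 'a compl0 \<Rightarrow> bool"
  where "converges_to \<rho> f l \<longleftrightarrow>
    (case l of
       None \<Rightarrow> (\<forall>\<^sub>F n in sequentially. f n = None)
     | Some Q \<Rightarrow> Q \<in> completion \<rho> \<and>
         (\<forall>\<^sub>F n in sequentially. f n \<in> Some ` completion \<rho>) \<and>
         (\<lambda>n. cdist \<rho> (the (f n)) Q) \<longlonglongrightarrow> 0)"

definition qtheta :: "'a::comm_semiring_1 \<Rightarrow> rat \<Rightarrow> 'a compl0 \<Rightarrow> 'a compl0"
  where "qtheta \<rho> \<alpha> x = map_option (lift1 \<rho> (qpow \<alpha>)) x"

text \<open>\<open>\<theta>\<^sub>\<lambda>(x) = x\<^sup>\<lambda>\<close> for real \<open>\<lambda> > 0\<close>, by continuity in the exponent.\<close>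

definition theta :: "'a::comm_semiring_1 \<Rightarrow> real \<Rightarrow> 'a compl0 \<Rightarrow> 'a compl0"
  where "theta \<rho> l x =
    (THE y. \<forall>q. (\<forall>n. 0 < q n) \<and> (\<lambda>n. real_of_rat (q n)) \<longlonglongrightarrow> l \<longrightarrow>
       converges_to \<rho> (\<lambda>n. qtheta \<rho> (q n) x) y)"

definition rho_pow :: "'a::comm_semiring_1 \<Rightarrow> real \<Rightarrow> 'a compl0"
  where "rho_pow \<rho> l =
    (if 0 < l then theta \<rho> l (of_R \<rho> \<rho>)
     else if l = 0 then \<one>\<^bsub>Rbar \<rho>\<^esub>
     else inv\<^bsub>Rbar \<rho>\<^esub> (theta \<rho> (- l) (of_R \<rho> \<rho>)))"


section \<open>The addition \<open>+\<^sub>w\<close>\<close>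

text \<open>Since \<open>ln 0 = 0\<close> in HOL, this formula yields \<open>S(0) = S(1) = 0\<close>.\<close>

definition entropy_S :: "real \<Rightarrow> real"
  where "entropy_S a = - a * ln a - (1 - a) * ln (1 - a)"

definition w :: "'a::comm_semiring_1 \<Rightarrow> real \<Rightarrow> 'a compl0"
  where "w \<rho> a = rho_pow \<rho> (entropy_S a)"

definition mix :: "'a::comm_semiring_1 \<Rightarrow> real \<Rightarrow> 'a compl0 \<Rightarrow> 'a compl0 \<Rightarrow> 'a compl0"
  where "mix \<rho> a x y =
    (if a = 1 then x else if a = 0 then y else theta \<rho> a x \<otimes>\<^bsub>Rbar \<rho>\<^esub> theta \<rho> (1 - a) y)"

text \<open>The \<open>n\<close>-th sum runs over \<open>k / n\<close>, \<open>0 \<le> k \<le> n\<close>, in the idempotent semi-ring \<open>Rbar \<rho>\<close>; the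
  value at \<open>n = 0\<close> is irrelevant for the limit.\<close>

definition wadd :: "'a::comm_semiring_1 \<Rightarrow> 'a compl0 \<Rightarrow> 'a compl0 \<Rightarrow> 'a compl0"
  where "wadd \<rho> x y =
    (THE z. converges_to \<rho>
       (\<lambda>n. \<Oplus>\<^bsub>Rbar \<rho>\<^esub>k\<in>{0..n}. w \<rho> (real k / real n) \<otimes>\<^bsub>Rbar \<rho>\<^esub> mix \<rho> (real k / real n) x y) z)"

definition Rbar_w :: "'a::comm_semiring_1 \<Rightarrow> 'a compl0 ring"
  where "Rbar_w \<rho> = (Rbar \<rho>)\<lparr>add := wadd \<rho>\<rparr>"


section \<open>Symmetrization\<close>

definition sym_rel :: "('b, 'm) ring_scheme \<Rightarrow> (('b \<times> 'b) \<times> ('b \<times> 'b)) set"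
  where "sym_rel A =
    {((a, b), (a', b')). a \<in> carrier A \<and> b \<in> carrier A \<and> a' \<in> carrier A \<and> b' \<in> carrier A \<and>
       (\<exists>c\<in>carrier A. a \<oplus>\<^bsub>A\<^esub> b' \<oplus>\<^bsub>A\<^esub> c = a' \<oplus>\<^bsub>A\<^esub> b \<oplus>\<^bsub>A\<^esub> c)}"

definition sym_class :: "('b, 'm) ring_scheme \<Rightarrow> 'b \<times> 'b \<Rightarrow> ('b \<times> 'b) set"
  where "sym_class A p = sym_rel A `` {p}"

definition symmetrization :: "('b, 'm) ring_scheme \<Rightarrow> ('b \<times> 'b) set ring"
  where "symmetrization A = \<lparr>
    carrier = (carrier A \<times> carrier A) // sym_rel A,
    monoid.mult = (\<lambda>P Q. \<Union>(a, b)\<in>P. \<Union>(c, d)\<in>Q.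
        sym_class A (a \<otimes>\<^bsub>A\<^esub> c \<oplus>\<^bsub>A\<^esub> b \<otimes>\<^bsub>A\<^esub> d, a \<otimes>\<^bsub>A\<^esub> d \<oplus>\<^bsub>A\<^esub> b \<otimes>\<^bsub>A\<^esub> c)),
    one = sym_class A (\<one>\<^bsub>A\<^esub>, \<zero>\<^bsub>A\<^esub>),
    ring.zero = sym_class A (\<zero>\<^bsub>A\<^esub>, \<zero>\<^bsub>A\<^esub>),
    add = (\<lambda>P Q. \<Union>(a, b)\<in>P. \<Union>(c, d)\<in>Q. sym_class A (a \<oplus>\<^bsub>A\<^esub> c, b \<oplus>\<^bsub>A\<^esub> d))\<rparr>"


section \<open>The ring \<open>W(R,\<rho>)\<close> and its real structure\<close>

definition W :: "'a::comm_semiring_1 \<Rightarrow> ('a compl0 \<times> 'a compl0) set ring"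
  where "W \<rho> = symmetrization (Rbar_w \<rho>)"

definition W_struct :: "'a::comm_semiring_1 \<Rightarrow> real \<Rightarrow> ('a compl0 \<times> 'a compl0) set"
  where "W_struct \<rho> s =
    (if s = 0 then \<zero>\<^bsub>W \<rho>\<^esub>
     else if 0 < s then sym_class (Rbar_w \<rho>) (rho_pow \<rho> (ln s), \<zero>\<^bsub>Rbar_w \<rho>\<^esub>)
     else sym_class (Rbar_w \<rho>) (\<zero>\<^bsub>Rbar_w \<rho>\<^esub>, rho_pow \<rho> (ln \<bar>s\<bar>)))"

text \<open>\<open>W \<rho>\<close> with the scalar multiplication induced by \<open>W_struct \<rho>\<close>.\<close>

definition W_alg :: "'a::comm_semiring_1 \<Rightarrow> (real, ('a compl0 \<times> 'a compl0) set) module"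
  where "W_alg \<rho> =
    ring.extend (W \<rho>) (module.fields (\<lambda>s x. W_struct \<rho> s \<otimes>\<^bsub>W \<rho>\<^esub> x))"

end

theory Submission
  imports Defs "HOL-Analysis.Uniform_Limit"
begin

text \<open>
  The idea is to realise \<open>Rbar \<rho>\<close> as a semi-ring of bounded real functions, in the spirit of
  the Kakutani--Yosida representation of Archimedean vector lattices with a strong unit; in that
  picture the addition \<open>+\<^sub>w\<close> is pointwise addition of real numbers written in logarithmic
  coordinates, and every law to be proved is inherited from the positive reals.

  A character is a map \<open>\<phi>\<close> from the nonzero bounded elements of \<open>R\<close> to the reals that turns
  products into sums, sums into maxima, and has \<open>\<phi> \<rho> = 1\<close>.  There are enough of them: if
  \<open>x \<preceq> y\<close> fails, then some \<open>\<phi>\<close> has \<open>\<phi> y \<le> \<phi> x\<close> (\<open>character_separation\<close>).  By Zorn's lemma the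
  order extends to a maximal cancellative preorder compatible with both operations in which
  \<open>x \<preceq> y\<close> still fails.  Such a preorder is total, because it can be enlarged by either of two
  incomparable pairs \<open>(p, q)\<close>, \<open>(q, p)\<close>, and whatever follows from both enlargements was already
  true, since \<open>(p + q)\<^sup>n = p\<^sup>n + q\<^sup>n\<close>.  In a total preorder, measuring elements by powers of \<open>\<rho>\<close>
  gives a character.

  Applied to \<open>x\<close> and \<open>y \<rho>\<^sup>\<alpha>\<close>, separation says that the pseudo-metric is the sup distance between
  evaluations at the characters (\<open>pdist_le_iff\<close>).  The completion is therefore the uniform closure
  of the evaluations (\<open>completion_eq\<close>), on which multiplication, addition and \<open>x\<^sup>\<lambda>\<close> become \<open>f + g\<close>,
  \<open>max f g\<close> and \<open>\<lambda> f\<close>, while \<open>\<rho>\<^sup>\<lambda>\<close> is the constant function \<open>\<lambda>\<close>.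

  The sums defining \<open>+\<^sub>w\<close> then are maxima over a grid of \<open>S(\<alpha>) + \<alpha> f + (1 - \<alpha>) g\<close>.  By the Gibbs
  variational principle the maximum over all \<open>\<alpha>\<close> in \<open>[0, 1]\<close> is \<open>ln (exp f + exp g)\<close>, and uniform
  continuity of the entropy makes the grid maxima converge to it uniformly (\<open>wadd_Some\<close>).  So
  \<open>exp\<close> carries \<open>+\<^sub>w\<close> and the product to the pointwise sum and product of positive functions,
  \<open>Rbar_w \<rho>\<close> is a commutative semi-ring, and \<open>s \<mapsto> \<rho>\<^bsup>log s\<^esup>\<close>, which becomes the constant
  function \<open>s\<close>, is a homomorphism from the nonnegative reals.  Symmetrization turns commutative
  semi-rings into commutative rings and extends this homomorphism to all reals.
\<close>

section \<open>Uniform limits of maxima, entropy and \<open>ln (exp x + exp y)\<close>\<close>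

lemma uniform_limit_max:
  fixes f g :: "'b \<Rightarrow> 'c \<Rightarrow> real"
  assumes "uniform_limit S f f0 F" "uniform_limit S g g0 F"
  shows "uniform_limit S (\<lambda>n x. max (f n x) (g n x)) (\<lambda>x. max (f0 x) (g0 x)) F"
proof (rule uniform_limitI)
  fix e :: real assume "0 < e"
  from uniform_limitD[OF assms(1) this] uniform_limitD[OF assms(2) this]
  show "\<forall>\<^sub>F n in F. \<forall>x\<in>S. dist (max (f n x) (g n x)) (max (f0 x) (g0 x)) < e"
  proof eventually_elim
    case (elim n)
    show ?case
    proof
      fix x assume "x \<in> S"
      with elim have "dist (f n x) (f0 x) < e" "dist (g n x) (g0 x) < e" by auto
      then show "dist (max (f n x) (g n x)) (max (f0 x) (g0 x)) < e"
        unfolding dist_real_def by linarith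
    qed
  qed
qed

text \<open>The Gibbs inequality: \<open>b ln (exp z / (b Z)) \<le> exp z / Z - b\<close>, which is \<open>ln t \<le> t - 1\<close>, is
  applied to \<open>(b, z) = (a, x)\<close> and \<open>(1 - a, y)\<close>; with \<open>Z = exp x + exp y\<close> the right-hand sides add up
  to \<open>0\<close>.\<close>
lemma entropy_le_log_sum_exp:
  assumes "0 \<le> a" "a \<le> 1"
  shows "entropy_S a + a * x + (1 - a) * y \<le> ln (exp x + exp y)"
proof -
  define Z where "Z = exp x + exp y"
  have Z: "0 < Z" unfolding Z_def by (simp add: add_pos_pos)
  have summand: "b * z - b * ln b - b * ln Z \<le> exp z / Z - b" if "0 \<le> b" for b z :: real
  proof (cases "b = 0")
    case False
    then have b: "0 < b" using that by simp
    have "ln (exp z / (b * Z)) \<le> exp z / (b * Z) - 1"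
      using b Z by (intro ln_le_minus_one) simp
    moreover have "ln (exp z / (b * Z)) = z - ln b - ln Z"
      using b Z by (simp add: ln_div ln_mult)
    ultimately have "b * (z - ln b - ln Z) \<le> b * (exp z / (b * Z) - 1)"
      using b by (intro mult_left_mono) auto
    also have "\<dots> = exp z / Z - b" using b Z by (simp add: field_simps)
    finally show ?thesis by (simp add: algebra_simps)
  qed (use Z in simp)
  have "entropy_S a + a * x + (1 - a) * y - ln Z
      = (a * x - a * ln a - a * ln Z) + ((1 - a) * y - (1 - a) * ln (1 - a) - (1 - a) * ln Z)"
    unfolding entropy_S_def by (simp add: algebra_simps)
  also have "\<dots> \<le> (exp x / Z - a) + (exp y / Z - (1 - a))"
    using assms by (intro add_mono summand) auto
  also have "\<dots> = (exp x + exp y) / Z - 1" by (simp add: add_divide_distrib)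
  also have "\<dots> = 0" using Z unfolding Z_def by simp
  finally show ?thesis unfolding Z_def by simp
qed

text \<open>Equality holds at the Gibbs weight, for which both \<open>x - ln a\<close> and \<open>y - ln (1 - a)\<close> equal
  \<open>ln (exp x + exp y)\<close>.\<close>
lemma entropy_eq_log_sum_exp:
  fixes x y :: real
  defines "a \<equiv> exp x / (exp x + exp y)"
  shows "0 \<le> a" "a \<le> 1" "entropy_S a + a * x + (1 - a) * y = ln (exp x + exp y)"
proof -
  define Z where "Z = exp x + exp y"
  have Z: "0 < Z" unfolding Z_def by (simp add: add_pos_pos)
  have a: "a = exp x / Z" "1 - a = exp y / Z"
    unfolding a_def Z_def[symmetric] using Z by (simp_all add: field_simps) (simp add: Z_def)
  show "0 \<le> a" unfolding a(1) using Z by simp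
  have "0 \<le> 1 - a" unfolding a(2) using Z by simp
  then show "a \<le> 1" by simp
  have "ln a = x - ln Z" unfolding a(1) using Z by (simp add: ln_div)
  moreover have "ln (1 - a) = y - ln Z" unfolding a(2) using Z by (simp add: ln_div)
  ultimately have logs: "x - ln a = ln Z" "y - ln (1 - a) = ln Z" by simp_all
  have "entropy_S a + a * x + (1 - a) * y = a * (x - ln a) + (1 - a) * (y - ln (1 - a))"
    unfolding entropy_S_def by (simp add: algebra_simps)
  also have "\<dots> = ln Z" unfolding logs by (simp add: algebra_simps)
  finally show "entropy_S a + a * x + (1 - a) * y = ln (exp x + exp y)" unfolding Z_def .
qed

lemma continuous_on_x_ln_x: "continuous_on {0..1} (\<lambda>x::real. x * ln x)"
  unfolding continuous_on_def
proof
  fix x :: real assume x: "x \<in> {0..1}"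
  show "((\<lambda>x. x * ln x) \<longlongrightarrow> x * ln x) (at x within {0..1})"
  proof (cases "x = 0")
    case True
    \<comment> \<open>From \<open>ln (1 / sqrt t) \<le> 1 / sqrt t\<close>; a power bound is needed only at the endpoint \<open>0\<close>.\<close>
    have bound: "\<bar>t * ln t\<bar> \<le> 2 * sqrt t" if "0 < t" "t \<le> 1" for t :: real
    proof -
      have "ln (1 / sqrt t) \<le> 1 / sqrt t - 1" using that by (intro ln_le_minus_one) simp
      then have "- ln t \<le> 2 / sqrt t" using that by (simp add: ln_div ln_sqrt)
      then have "t * (- ln t) \<le> t * (2 / sqrt t)" using that by (intro mult_left_mono) auto
      also have "\<dots> = 2 * (t / sqrt t)" by simp
      also have "\<dots> = 2 * sqrt t" using that real_div_sqrt[of t] by simp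
      finally show ?thesis using that by (simp add: abs_mult)
    qed
    have "((\<lambda>t. 2 * sqrt t) \<longlongrightarrow> 2 * sqrt 0) (at 0 within {0..1})" by (intro tendsto_intros)
    then have lim: "((\<lambda>t. 2 * sqrt t) \<longlongrightarrow> 0) (at 0 within {0..1})" by simp
    have "((\<lambda>x::real. x * ln x) \<longlongrightarrow> 0) (at 0 within {0..1})"
      by (rule Lim_null_comparison[OF _ lim]) (auto simp: eventually_at intro!: exI[of _ 1] bound)
    then show ?thesis using True by simp
  next
    case False
    then have "0 < x" using x by simp
    then show ?thesis by (intro tendsto_intros) auto
  qed
qed

lemma continuous_on_entropy: "continuous_on {0..1} entropy_S"
proof -
  have "continuous_on {0..1} (\<lambda>a::real. - (a * ln a) - (1 - a) * ln (1 - a))"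
    by (intro continuous_intros continuous_on_x_ln_x continuous_on_compose2[OF continuous_on_x_ln_x]) auto
  then show ?thesis unfolding entropy_S_def by simp
qed

text \<open>The convergence is uniform in \<open>x\<close> and \<open>y\<close> as long as \<open>\<bar>x - y\<bar>\<close> stays bounded: the grid contains a
  point within \<open>1 / n\<close> of the Gibbs weight, and moving there changes the linear part by at most \<open>M / n\<close>
  and the entropy by little, by uniform continuity.  Uniformity is what makes the grid sums converge
  in the completion.\<close>
lemma grid_maximum_tends_to_log_sum_exp:
  assumes "0 < e" "0 \<le> M"
  obtains N where "\<And>n x y. N \<le> n \<Longrightarrow> \<bar>x - y\<bar> \<le> M \<Longrightarrow>
    \<bar>(MAX k\<in>{0..n}. entropy_S (real k / real n) + (real k / real n * x + (1 - real k / real n) * y))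
      - ln (exp x + exp y)\<bar> \<le> e"
proof -
  have "uniformly_continuous_on {0..1} entropy_S"
    by (rule compact_uniformly_continuous[OF continuous_on_entropy]) simp
  then obtain d where d: "0 < d" "\<And>a b. a \<in> {0..1} \<Longrightarrow> b \<in> {0..1} \<Longrightarrow> dist b a < d \<Longrightarrow>
      dist (entropy_S b) (entropy_S a) < e / 2"
    using assms(1) unfolding uniformly_continuous_on_def by (metis half_gt_zero)
  define N where "N = nat \<lceil>1 / d\<rceil> + nat \<lceil>2 * M / e\<rceil> + 1"
  have "\<bar>(MAX k\<in>{0..n}. entropy_S (real k / real n) + (real k / real n * x + (1 - real k / real n) * y))
      - ln (exp x + exp y)\<bar> \<le> e" (is "\<bar>?m - ?L\<bar> \<le> e")
    if n: "N \<le> n" and xy: "\<bar>x - y\<bar> \<le> M" for n x y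
  proof -
    have n0: "0 < n" using n unfolding N_def by simp
    have "1 / d < real n" "2 * M / e \<le> real n"
      using n unfolding N_def by linarith+
    then have nd: "1 / real n < d" and nM: "M / real n \<le> e / 2"
      using n0 d(1) assms by (simp_all add: field_simps)
    define a where "a = exp x / (exp x + exp y)"
    have a: "0 \<le> a" "a \<le> 1" "entropy_S a + a * x + (1 - a) * y = ?L"
      using entropy_eq_log_sum_exp[of x y] unfolding a_def by auto
    define k where "k = nat \<lfloor>a * real n\<rfloor>"
    have an: "a * real n \<le> 1 * real n" using a by (intro mult_right_mono) auto
    have k: "real k \<le> a * real n" "a * real n < real k + 1"
      unfolding k_def using a(1) by simp_all
    have "k \<le> n" using k(1) an by simp
    define b where "b = real k / real n"
    have b: "0 \<le> b" "b \<le> a" "a < b + 1 / real n"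
      using k n0 unfolding b_def by (simp_all add: field_simps)
    have S: "\<bar>entropy_S b - entropy_S a\<bar> < e / 2"
      using d(2)[of a b] a b nd by (simp add: dist_real_def)
    have "\<bar>(a - b) * (x - y)\<bar> \<le> 1 / real n * M"
      unfolding abs_mult using b xy by (intro mult_mono) auto
    also have "\<dots> \<le> e / 2" using nM by (simp only: times_divide_eq_left mult_1)
    finally have lin: "\<bar>(a - b) * (x - y)\<bar> \<le> e / 2" .
    have "?L - (entropy_S b + (b * x + (1 - b) * y)) = (entropy_S a - entropy_S b) + (a - b) * (x - y)"
      unfolding a(3)[symmetric] by (simp add: algebra_simps)
    also have "\<dots> \<le> e / 2 + e / 2" using S abs_le_D1[OF lin] by (intro add_mono) linarith+
    finally have "?L - e \<le> entropy_S b + (b * x + (1 - b) * y)" by simp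
    also have "\<dots> \<le> ?m" unfolding b_def using \<open>k \<le> n\<close> by (intro Max_ge) auto
    finally have 1: "?L - e \<le> ?m" .
    have "?m \<le> ?L"
    proof (subst Max_le_iff)
      show "\<forall>t\<in>(\<lambda>k. entropy_S (real k / real n) + (real k / real n * x + (1 - real k / real n) * y)) ` {0..n}.
        t \<le> ?L"
        using entropy_le_log_sum_exp[of "real _ / real n" x y] n0 by (auto simp: add.assoc)
    qed auto
    with 1 assms(1) show ?thesis by linarith
  qed
  then show thesis using that by blast
qed

section \<open>Symmetrization of a commutative semi-ring\<close>

locale commutative_semiring = semiring A for A (structure) +
  assumes m_comm: "x \<in> carrier A \<Longrightarrow> y \<in> carrier A \<Longrightarrow> x \<otimes> y = y \<otimes> x"
begin

lemma m_lcomm: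
  "x \<in> carrier A \<Longrightarrow> y \<in> carrier A \<Longrightarrow> z \<in> carrier A \<Longrightarrow> x \<otimes> (y \<otimes> z) = y \<otimes> (x \<otimes> z)"
  by (metis m_assoc m_comm)

lemmas semiring_ac = a_ac m_assoc m_comm m_lcomm l_distr r_distr

lemma sym_rel_iff:
  "((a, b), (a', b')) \<in> sym_rel A \<longleftrightarrow>
    a \<in> carrier A \<and> b \<in> carrier A \<and> a' \<in> carrier A \<and> b' \<in> carrier A \<and>
    (\<exists>c\<in>carrier A. a \<oplus> b' \<oplus> c = a' \<oplus> b \<oplus> c)"
  unfolding sym_rel_def by simp

lemma sym_rel_refl:
  "a \<in> carrier A \<Longrightarrow> b \<in> carrier A \<Longrightarrow> ((a, b), (a, b)) \<in> sym_rel A"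
  unfolding sym_rel_iff by blast

lemma sym_rel_trans:
  assumes "((a, b), (a', b')) \<in> sym_rel A" "((a', b'), (a'', b'')) \<in> sym_rel A"
  shows "((a, b), (a'', b'')) \<in> sym_rel A"
proof -
  obtain c d where C: "a \<in> carrier A" "b \<in> carrier A" "a' \<in> carrier A" "b' \<in> carrier A"
      "a'' \<in> carrier A" "b'' \<in> carrier A" "c \<in> carrier A" "d \<in> carrier A"
    and eq: "a \<oplus> b' \<oplus> c = a' \<oplus> b \<oplus> c" "a' \<oplus> b'' \<oplus> d = a'' \<oplus> b' \<oplus> d"
    using assms unfolding sym_rel_iff by blast
  have "a \<oplus> b'' \<oplus> (b' \<oplus> c \<oplus> d) = (a \<oplus> b' \<oplus> c) \<oplus> (b'' \<oplus> d)" using C by (simp add: a_ac)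
  also have "\<dots> = (a' \<oplus> b'' \<oplus> d) \<oplus> (b \<oplus> c)" unfolding eq(1) using C by (simp add: a_ac)
  also have "\<dots> = a'' \<oplus> b \<oplus> (b' \<oplus> c \<oplus> d)" unfolding eq(2) using C by (simp add: a_ac)
  finally show ?thesis unfolding sym_rel_iff using C by blast
qed

lemma sym_rel_equiv: "equiv (carrier A \<times> carrier A) (sym_rel A)"
proof (rule equivI)
  show "sym_rel A \<subseteq> (carrier A \<times> carrier A) \<times> (carrier A \<times> carrier A)"
    unfolding sym_rel_def by auto
  show "refl_on (carrier A \<times> carrier A) (sym_rel A)"
    unfolding refl_on_def using sym_rel_refl by auto
  show "sym (sym_rel A)" unfolding sym_def sym_rel_def by (auto dest: sym)
  show "trans (sym_rel A)" unfolding trans_def using sym_rel_trans by fast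
qed

lemma sym_class_eqI: "(p, q) \<in> sym_rel A \<Longrightarrow> sym_class A p = sym_class A q"
  unfolding sym_class_def by (rule equiv_class_eq[OF sym_rel_equiv])

lemma mem_sym_class: "q \<in> sym_class A p \<longleftrightarrow> (p, q) \<in> sym_rel A"
  unfolding sym_class_def by simp

lemma sym_carrierE:
  assumes "P \<in> carrier (symmetrization A)"
  obtains a b where "a \<in> carrier A" "b \<in> carrier A" "P = sym_class A (a, b)"
  using assms unfolding symmetrization_def sym_class_def by (auto elim!: quotientE)

lemma sym_class_closed [simp]:
  "a \<in> carrier A \<Longrightarrow> b \<in> carrier A \<Longrightarrow> sym_class A (a, b) \<in> carrier (symmetrization A)"
  unfolding symmetrization_def sym_class_def by (auto intro: quotientI)

lemma sym_rel_add:
  assumes "((a, b), (a', b')) \<in> sym_rel A" "((c, d), (c', d')) \<in> sym_rel A"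
  shows "((a \<oplus> c, b \<oplus> d), (a' \<oplus> c', b' \<oplus> d')) \<in> sym_rel A"
proof -
  obtain e f where C: "a \<in> carrier A" "b \<in> carrier A" "a' \<in> carrier A" "b' \<in> carrier A"
      "c \<in> carrier A" "d \<in> carrier A" "c' \<in> carrier A" "d' \<in> carrier A" "e \<in> carrier A" "f \<in> carrier A"
    and eq: "a \<oplus> b' \<oplus> e = a' \<oplus> b \<oplus> e" "c \<oplus> d' \<oplus> f = c' \<oplus> d \<oplus> f"
    using assms unfolding sym_rel_iff by blast
  have "a \<oplus> c \<oplus> (b' \<oplus> d') \<oplus> (e \<oplus> f) = (a \<oplus> b' \<oplus> e) \<oplus> (c \<oplus> d' \<oplus> f)" using C by (simp add: a_ac)
  also have "\<dots> = a' \<oplus> c' \<oplus> (b \<oplus> d) \<oplus> (e \<oplus> f)" unfolding eq using C by (simp add: a_ac)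
  finally show ?thesis unfolding sym_rel_iff using C by blast
qed

lemma sym_rel_mult_right:
  assumes "((a, b), (a', b')) \<in> sym_rel A" and cd: "c \<in> carrier A" "d \<in> carrier A"
  shows "((a \<otimes> c \<oplus> b \<otimes> d, a \<otimes> d \<oplus> b \<otimes> c), (a' \<otimes> c \<oplus> b' \<otimes> d, a' \<otimes> d \<oplus> b' \<otimes> c)) \<in> sym_rel A"
proof -
  obtain e where C: "a \<in> carrier A" "b \<in> carrier A" "a' \<in> carrier A" "b' \<in> carrier A" "e \<in> carrier A"
    and eq: "a \<oplus> b' \<oplus> e = a' \<oplus> b \<oplus> e"
    using assms unfolding sym_rel_iff by blast
  have "a \<otimes> c \<oplus> b \<otimes> d \<oplus> (a' \<otimes> d \<oplus> b' \<otimes> c) \<oplus> (e \<otimes> c \<oplus> e \<otimes> d)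
      = (a \<oplus> b' \<oplus> e) \<otimes> c \<oplus> (a' \<oplus> b \<oplus> e) \<otimes> d" using C cd by (simp add: l_distr a_ac)
  also have "\<dots> = (a' \<oplus> b \<oplus> e) \<otimes> c \<oplus> (a \<oplus> b' \<oplus> e) \<otimes> d" unfolding eq ..
  also have "\<dots> = a' \<otimes> c \<oplus> b' \<otimes> d \<oplus> (a \<otimes> d \<oplus> b \<otimes> c) \<oplus> (e \<otimes> c \<oplus> e \<otimes> d)"
    using C cd by (simp add: l_distr a_ac)
  finally show ?thesis unfolding sym_rel_iff using C cd
    by (intro conjI bexI[of _ "e \<otimes> c \<oplus> e \<otimes> d"]) simp_all
qed

text \<open>Both factors are changed one at a time, the second one by commutativity.\<close>
lemma sym_rel_mult:
  assumes "((a, b), (a', b')) \<in> sym_rel A" "((c, d), (c', d')) \<in> sym_rel A"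
  shows "((a \<otimes> c \<oplus> b \<otimes> d, a \<otimes> d \<oplus> b \<otimes> c), (a' \<otimes> c' \<oplus> b' \<otimes> d', a' \<otimes> d' \<oplus> b' \<otimes> c')) \<in> sym_rel A"
proof -
  have C: "a \<in> carrier A" "b \<in> carrier A" "a' \<in> carrier A" "b' \<in> carrier A"
      "c \<in> carrier A" "d \<in> carrier A" "c' \<in> carrier A" "d' \<in> carrier A"
    using assms unfolding sym_rel_iff by blast+
  show ?thesis
    using sym_rel_trans[OF sym_rel_mult_right[OF assms(1) C(5,6)]] sym_rel_mult_right[OF assms(2) C(3,4)] C
    by (simp add: m_comm a_comm)
qed

text \<open>The operations of the symmetrization are unions over representatives; this evaluates them once
  the result is independent of the representatives.\<close>
lemma Union_sym_class:
  assumes "a \<in> carrier A" "b \<in> carrier A" "c \<in> carrier A" "d \<in> carrier A"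
    and "\<And>a' b' c' d'. ((a, b), (a', b')) \<in> sym_rel A \<Longrightarrow> ((c, d), (c', d')) \<in> sym_rel A \<Longrightarrow>
      h a' b' c' d' = S"
  shows "(\<Union>(a', b')\<in>sym_class A (a, b). \<Union>(c', d')\<in>sym_class A (c, d). h a' b' c' d') = S"
proof (intro subset_antisym subsetI)
  fix z assume "z \<in> S"
  then have "z \<in> h a b c d" using assms sym_rel_refl by simp
  then have "z \<in> (\<Union>(c', d')\<in>sym_class A (c, d). h a b c' d')"
    using assms(3,4) sym_rel_refl by (intro UN_I[of "(c, d)"]) (auto simp: mem_sym_class)
  then show "z \<in> (\<Union>(a', b')\<in>sym_class A (a, b). \<Union>(c', d')\<in>sym_class A (c, d). h a' b' c' d')"
    using assms(1,2) sym_rel_refl by (intro UN_I[of "(a, b)"]) (auto simp: mem_sym_class)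
qed (use assms(5) in \<open>auto simp: mem_sym_class\<close>)

lemma sym_add:
  assumes "a \<in> carrier A" "b \<in> carrier A" "c \<in> carrier A" "d \<in> carrier A"
  shows "sym_class A (a, b) \<oplus>\<^bsub>symmetrization A\<^esub> sym_class A (c, d) = sym_class A (a \<oplus> c, b \<oplus> d)"
  unfolding symmetrization_def ring.simps
  by (rule Union_sym_class[OF assms]) (rule sym_class_eqI[OF sym_rel_add, symmetric])

lemma sym_mult:
  assumes "a \<in> carrier A" "b \<in> carrier A" "c \<in> carrier A" "d \<in> carrier A"
  shows "sym_class A (a, b) \<otimes>\<^bsub>symmetrization A\<^esub> sym_class A (c, d)
    = sym_class A (a \<otimes> c \<oplus> b \<otimes> d, a \<otimes> d \<oplus> b \<otimes> c)"
  unfolding symmetrization_def monoid.simps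
  by (rule Union_sym_class[OF assms]) (rule sym_class_eqI[OF sym_rel_mult, symmetric])

lemma sym_zero: "\<zero>\<^bsub>symmetrization A\<^esub> = sym_class A (\<zero>, \<zero>)"
  and sym_one: "\<one>\<^bsub>symmetrization A\<^esub> = sym_class A (\<one>, \<zero>)"
  unfolding symmetrization_def by simp_all

theorem symmetrization_cring: "cring (symmetrization A)"
proof (rule cringI)
  show "abelian_group (symmetrization A)"
  proof (rule abelian_groupI)
    fix P assume "P \<in> carrier (symmetrization A)"
    then obtain a b where P: "a \<in> carrier A" "b \<in> carrier A" "P = sym_class A (a, b)"
      by (rule sym_carrierE)
    \<comment> \<open>Only the inverse needs the quotient; the other laws hold for pairs already.\<close>
    have "sym_class A (b \<oplus> a, a \<oplus> b) = sym_class A (\<zero>, \<zero>)"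
      by (rule sym_class_eqI) (use P in \<open>auto simp: sym_rel_iff a_comm intro: exI[of _ "\<zero>"]\<close>)
    then show "\<exists>Q\<in>carrier (symmetrization A). Q \<oplus>\<^bsub>symmetrization A\<^esub> P = \<zero>\<^bsub>symmetrization A\<^esub>"
      using P by (intro bexI[of _ "sym_class A (b, a)"]) (simp_all add: sym_add sym_zero)
  qed (auto simp: sym_add sym_zero a_ac elim!: sym_carrierE)
  show "Group.comm_monoid (symmetrization A)"
    by (rule comm_monoidI) (auto simp: sym_mult sym_one semiring_ac elim!: sym_carrierE)
qed (auto simp: sym_mult sym_add semiring_ac elim!: sym_carrierE)

text \<open>Any decomposition \<open>s = p - q\<close> with \<open>p, q \<ge> 0\<close> gives the same class, so sums and products can be
  computed from the positive and negative parts without ordering the arguments by sign.\<close>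
lemma symmetrization_hom:
  assumes closed: "\<And>s. 0 \<le> s \<Longrightarrow> c s \<in> carrier A"
    and zero: "c 0 = \<zero>" and one: "c 1 = \<one>"
    and add: "\<And>s t. 0 \<le> s \<Longrightarrow> 0 \<le> t \<Longrightarrow> c (s + t) = c s \<oplus> c t"
    and mult: "\<And>s t. 0 \<le> s \<Longrightarrow> 0 \<le> t \<Longrightarrow> c (s * t) = c s \<otimes> c t"
  shows "(\<lambda>s::real. sym_class A (c (max s 0), c (max (- s) 0)))
    \<in> ring_hom (ring_of_type_algebra :: real ring) (symmetrization A)"
proof -
  let ?r = "\<lambda>s::real. sym_class A (c (max s 0), c (max (- s) 0))"
  have rep: "sym_class A (c p, c q) = ?r s" if "0 \<le> p" "0 \<le> q" "p - q = s" for p q s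
  proof (rule sym_class_eqI)
    have "p + max (- s) 0 = max s 0 + q" using that by linarith
    then have "c p \<oplus> c (max (- s) 0) = c (max s 0) \<oplus> c q"
      using add that by (metis max.cobounded2)
    then show "((c p, c q), (c (max s 0), c (max (- s) 0))) \<in> sym_rel A"
      unfolding sym_rel_iff using closed that by (intro conjI bexI[of _ "\<zero>"]) auto
  qed
  show ?thesis
  proof (rule ring_hom_memI)
    fix s t :: real
    have C: "c (max s 0) \<in> carrier A" "c (max (- s) 0) \<in> carrier A"
      "c (max t 0) \<in> carrier A" "c (max (- t) 0) \<in> carrier A" by (auto intro: closed)
    show "?r s \<in> carrier (symmetrization A)" using C by simp
    have "?r s \<oplus>\<^bsub>symmetrization A\<^esub> ?r t
        = sym_class A (c (max s 0 + max t 0), c (max (- s) 0 + max (- t) 0))"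
      using C by (simp add: sym_add add)
    also have "\<dots> = ?r (s + t)" by (rule rep) auto
    finally show "?r (s \<oplus>\<^bsub>ring_of_type_algebra\<^esub> t) = ?r s \<oplus>\<^bsub>symmetrization A\<^esub> ?r t"
      by (simp add: ring_of_type_algebra_def)
    have "?r s \<otimes>\<^bsub>symmetrization A\<^esub> ?r t
        = sym_class A (c (max s 0 * max t 0 + max (- s) 0 * max (- t) 0),
            c (max s 0 * max (- t) 0 + max (- s) 0 * max t 0))"
      using C by (simp add: sym_mult add mult)
    also have "\<dots> = ?r (s * t)" by (rule rep) (auto simp: max_def)
    finally show "?r (s \<otimes>\<^bsub>ring_of_type_algebra\<^esub> t) = ?r s \<otimes>\<^bsub>symmetrization A\<^esub> ?r t"
      by (simp add: ring_of_type_algebra_def)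
  next
    show "?r \<one>\<^bsub>ring_of_type_algebra\<^esub> = \<one>\<^bsub>symmetrization A\<^esub>"
      by (simp add: ring_of_type_algebra_def sym_one zero one)
  qed
qed

end

lemma algebra_of_ring_hom:
  fixes M :: "'m ring"
  assumes R: "cring R" and M: "cring M" and h: "h \<in> ring_hom R M"
  shows "algebra R (ring.extend M (module.fields (\<lambda>s x. h s \<otimes>\<^bsub>M\<^esub> x)))"
proof -
  interpret M: cring M by (rule M)
  let ?M = "ring.extend M (module.fields (\<lambda>s x. h s \<otimes>\<^bsub>M\<^esub> x))"
  have sel: "carrier ?M = carrier M" "monoid.mult ?M = monoid.mult M" "one ?M = one M"
    "ring.zero ?M = ring.zero M" "add ?M = add M" "Module.smult ?M = (\<lambda>s x. h s \<otimes>\<^bsub>M\<^esub> x)"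
    by (simp_all add: ring.defs module.defs)
  have "Group.comm_monoid ?M"
    by (rule comm_monoidI) (auto simp: sel M.m_ac)
  moreover have "abelian_group ?M"
    by (rule abelian_groupI) (auto simp: sel M.a_ac intro: M.add.l_inv_ex)
  ultimately have cring: "cring ?M"
    by (intro cringI) (auto simp: sel M.l_distr)
  note hom = ring_hom_closed[OF h] ring_hom_mult[OF h] ring_hom_add[OF h] ring_hom_one[OF h]
  show ?thesis
    by (rule algebraI[OF R cring]) (auto simp: sel hom M.l_distr M.r_distr M.m_assoc)
qed

section \<open>Perfect cancellative semi-rings of characteristic one\<close>

locale perfect_semiring =
  fixes \<rho> :: "'a::comm_semiring_1"
  assumes char_one: "(1::'a) + 1 = 1"
    and cancellative: "\<And>x y z :: 'a. x \<noteq> 0 \<Longrightarrow> x * y = x * z \<Longrightarrow> y = z"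
    and perfect: "\<And>n::nat. 1 \<le> n \<Longrightarrow> surj (\<lambda>x::'a. x ^ n)"
    and rho_unit: "\<rho> dvd 1"
    and rho_ge_1: "1 \<preceq> \<rho>"
    and rho_neq_1: "\<rho> \<noteq> 1"
begin

lemma add_idem: "(x::'a) + x = x"
  using char_one by (metis distrib_left mult_1_right)

lemma cle_refl: "(x::'a) \<preceq> x"
  by (simp add: char_le_def add_idem)

lemma cle_trans: "(x::'a) \<preceq> y \<Longrightarrow> y \<preceq> z \<Longrightarrow> x \<preceq> z"
  unfolding char_le_def by (metis add.assoc)

lemma cle_antisym: "(x::'a) \<preceq> y \<Longrightarrow> y \<preceq> x \<Longrightarrow> x = y"
  unfolding char_le_def by (metis add.commute)

lemma cle_add1: "(x::'a) \<preceq> x + y" and cle_add2: "(y::'a) \<preceq> x + y"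
  unfolding char_le_def by (metis add.assoc add_idem, metis add.left_commute add_idem)

lemma add_least: "(x::'a) \<preceq> z \<Longrightarrow> y \<preceq> z \<Longrightarrow> x + y \<preceq> z"
  unfolding char_le_def by (simp add: add.assoc)

lemma zero_cle: "(0::'a) \<preceq> x"
  by (simp add: char_le_def)

lemma cle_mult_right_mono: "(x::'a) \<preceq> y \<Longrightarrow> x * z \<preceq> y * z"
  unfolding char_le_def by (metis distrib_right)

lemma cle_mult_mono: "(x::'a) \<preceq> y \<Longrightarrow> z \<preceq> t \<Longrightarrow> x * z \<preceq> y * t"
  by (metis cle_trans mult.commute cle_mult_right_mono)

lemma cle_power_mono: "(x::'a) \<preceq> y \<Longrightarrow> x ^ n \<preceq> y ^ n"
  by (induction n) (auto intro: cle_mult_mono cle_refl)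

lemma sum_least: "(\<And>i. i \<in> A \<Longrightarrow> f i \<preceq> (z::'a)) \<Longrightarrow> (\<Sum>i\<in>A. f i) \<preceq> z"
  by (induction A rule: infinite_finite_induct) (auto intro: add_least zero_cle)

lemma mult_nonzero: "(x::'a) \<noteq> 0 \<Longrightarrow> y \<noteq> 0 \<Longrightarrow> x * y \<noteq> 0"
  using cancellative[of x y 0] by auto

lemma power_nonzero: "(x::'a) \<noteq> 0 \<Longrightarrow> x ^ n \<noteq> 0"
  by (induction n) (auto dest: mult_nonzero)

lemma add_eq_0D: assumes "(x::'a) + y = 0" shows "x = 0" "y = 0"
  using cle_add1[of x y] cle_add2[of y x] assms by (auto simp: char_le_def)

lemma mult_cle_cancel: "(z::'a) \<noteq> 0 \<Longrightarrow> x * z \<preceq> y * z \<Longrightarrow> x \<preceq> y"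
  unfolding char_le_def using cancellative[of z] by (metis distrib_right mult.commute)

lemma of_nat_eq_one: "0 < n \<Longrightarrow> (of_nat n :: 'a) = 1"
  by (induction n rule: nat_induct_non_zero) (simp_all only: of_nat_1 of_nat_Suc char_one)

text \<open>In characteristic one all binomial coefficients are \<open>1\<close>, and every monomial of degree \<open>2 n\<close> in
  \<open>x\<close> and \<open>y\<close> is divisible by \<open>x ^ n\<close> or by \<open>y ^ n\<close>.  Hence \<open>(x + y) ^ (2 * n)\<close> is below
  \<open>(x ^ n + y ^ n) * (x + y) ^ n\<close>, and \<open>(x + y) ^ n\<close> can be cancelled.\<close>
lemma power_add_eq: "((x::'a) + y) ^ n = x ^ n + y ^ n"
proof (cases "x + y = 0")
  case True
  then show ?thesis using add_eq_0D[OF True] by (cases n) (simp_all add: add_idem del: one_add_one)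
next
  case False
  have mono: "x ^ i * y ^ j \<preceq> (x + y) ^ (i + j)" for i j
    unfolding power_add by (intro cle_mult_mono cle_power_mono cle_add1 cle_add2)
  have "(x + y) ^ (2 * n) \<preceq> (x ^ n + y ^ n) * (x + y) ^ n"
    unfolding binomial_ring[of x y "2 * n"]
  proof (rule sum_least)
    fix k assume "k \<in> {..2 * n}"
    then have k: "k \<le> 2 * n" by simp
    have "x ^ k * y ^ (2 * n - k) \<preceq> (x ^ n + y ^ n) * (x + y) ^ n"
    proof (cases "n \<le> k")
      case True
      have "x ^ k * y ^ (2 * n - k) = x ^ n * (x ^ (k - n) * y ^ (2 * n - k))"
        using True by (simp flip: power_add mult.assoc)
      also have "\<dots> \<preceq> (x ^ n + y ^ n) * (x + y) ^ n"
        using mono[of "k - n" "2 * n - k"] True k by (intro cle_mult_mono cle_add1) simp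
      finally show ?thesis .
    next
      case False
      then have "n + (n - k) = 2 * n - k" by simp
      then have "x ^ k * y ^ (2 * n - k) = y ^ n * (x ^ k * y ^ (n - k))"
        by (metis mult.left_commute power_add)
      also have "\<dots> \<preceq> (x ^ n + y ^ n) * (x + y) ^ n"
        using mono[of k "n - k"] False by (intro cle_mult_mono cle_add2) simp
      finally show ?thesis .
    qed
    then show "of_nat (2 * n choose k) * x ^ k * y ^ (2 * n - k) \<preceq> (x ^ n + y ^ n) * (x + y) ^ n"
      using k by (simp add: of_nat_eq_one)
  qed
  then have "(x + y) ^ n * (x + y) ^ n \<preceq> (x ^ n + y ^ n) * (x + y) ^ n"
    by (simp add: mult_2 power_add)
  then have "(x + y) ^ n \<preceq> x ^ n + y ^ n"
    using False mult_cle_cancel power_nonzero by blast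
  moreover have "x ^ n + y ^ n \<preceq> (x + y) ^ n"
    by (intro add_least cle_power_mono cle_add1 cle_add2)
  ultimately show ?thesis by (rule cle_antisym)
qed

lemma power_inj_comparable:
  assumes "(y::'a) \<preceq> s" "s ^ Suc n = y ^ Suc n" shows "y = s"
proof (cases "s = 0")
  case False
  have "s * s ^ n \<preceq> y * s ^ n"
    using assms by (simp add: cle_mult_mono cle_power_mono cle_refl)
  then show ?thesis using False assms(1) cle_antisym mult_cle_cancel power_nonzero by blast
qed (use assms in \<open>simp add: char_le_def\<close>)

text \<open>By \<open>power_add_eq\<close> the element \<open>x + y\<close>, which lies above both, has the same \<open>n\<close>-th power.\<close>
lemma power_inj: assumes "(x::'a) ^ n = y ^ n" "0 < n" shows "x = y"
proof -
  obtain m where m: "n = Suc m" using assms(2) gr0_implies_Suc by blast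
  have "(x + y) ^ n = x ^ n" "(x + y) ^ n = y ^ n" by (auto simp: power_add_eq assms add_idem)
  then show ?thesis using power_inj_comparable[of _ "x + y" m] cle_add1 cle_add2 unfolding m by metis
qed

lemma power_cle_iff: "0 < n \<Longrightarrow> (x::'a) ^ n \<preceq> y ^ n \<longleftrightarrow> x \<preceq> y"
  unfolding char_le_def by (metis power_add_eq power_inj)

text \<open>The root of \<open>x ^ a\<close> exists by perfectness, and by injectivity of powers it does not depend on the
  representation of the exponent as a fraction.\<close>
lemma qpow_power:
  assumes "0 < a" "0 < b" shows "qpow (of_nat a / of_nat b) (x::'a) ^ b = x ^ a"
proof -
  define \<alpha> :: rat where "\<alpha> = of_nat a / of_nat b"
  obtain z where z: "z ^ b = x ^ a" using perfect[of b] assms by (metis One_nat_def Suc_leI surjD)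
  have all: "z ^ b' = x ^ a'" if "0 < a'" "0 < b'" "\<alpha> = of_nat a' / of_nat b'" for a' b'
  proof -
    have "(of_nat (a * b') :: rat) = of_nat (a' * b)"
      using that assms by (simp add: \<alpha>_def field_simps)
    then have "a * b' = a' * b" by (simp only: of_nat_eq_iff)
    then have "(z ^ b') ^ b = (x ^ a') ^ b"
      by (metis z power_mult mult.commute)
    then show ?thesis using power_inj assms by blast
  qed
  have "qpow \<alpha> x = z" unfolding qpow_def
  proof (rule the_equality)
    fix z' assume "\<forall>a b. 0 < a \<and> 0 < b \<and> \<alpha> = of_nat a / of_nat b \<longrightarrow> z' ^ b = x ^ a"
    then show "z' = z" using z power_inj assms \<alpha>_def by metis
  qed (use all in auto)
  then show ?thesis using z \<alpha>_def by simp
qed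

lemma pos_rat_cases:
  assumes "0 < (\<alpha>::rat)" obtains a b :: nat where "0 < a" "0 < b" "\<alpha> = of_nat a / of_nat b"
proof -
  obtain m n :: int where mn: "\<alpha> = of_int m / of_int n" "0 < n"
    by (metis quotient_of_div quotient_of_denom_pos surj_pair)
  then have "0 < m" using assms by (simp add: zero_less_divide_iff)
  then show thesis using that[of "nat m" "nat n"] mn by simp
qed

section \<open>The bounded part\<close>

text \<open>The points of the pseudo-metric space whose completion is taken.\<close>
definition E :: "'a set" where "E = bounded_part \<rho> - {0}"

abbreviation rho_inv :: 'a where "rho_inv \<equiv> unit_inv \<rho>"

lemma rho_rho_inv: "\<rho> * rho_inv = 1"
proof -
  obtain v where v: "1 = \<rho> * v" using rho_unit by (auto elim: dvdE)
  then have "\<rho> \<noteq> 0" by auto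
  have "unit_inv \<rho> = v" unfolding unit_inv_def
    by (rule the_equality) (use v cancellative[OF \<open>\<rho> \<noteq> 0\<close>] in auto)
  with v show ?thesis by simp
qed

lemma rho_inv_rho: "rho_inv * \<rho> = 1" by (metis rho_rho_inv mult.commute)

lemma rho_nonzero: "\<rho> \<noteq> 0"
  using rho_rho_inv by auto

lemma power_rho_rho_inv: "\<rho> ^ n * rho_inv ^ n = 1" by (metis power_mult_distrib rho_rho_inv power_one)

lemma one_le_rho_power: "1 \<preceq> \<rho> ^ n"
  using cle_power_mono[OF rho_ge_1, of n] by simp

lemma rho_power_mono: "m \<le> n \<Longrightarrow> \<rho> ^ m \<preceq> \<rho> ^ n"
  by (metis le_Suc_ex cle_mult_mono[OF cle_refl one_le_rho_power] power_add mult_1_right)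

text \<open>The lower bound in terms of powers of \<open>\<rho>\<close> itself, so that later comparisons involve
  natural exponents only.\<close>
lemma E_iff: "x \<in> E \<longleftrightarrow> (\<exists>n. 1 \<preceq> x * \<rho> ^ n \<and> x \<preceq> \<rho> ^ n)"
proof -
  have "rho_inv ^ n \<preceq> x \<longleftrightarrow> 1 \<preceq> x * \<rho> ^ n" for n x
    using cle_mult_right_mono[of "rho_inv ^ n" x "\<rho> ^ n"] mult_cle_cancel[of "\<rho> ^ n" "rho_inv ^ n" x]
      power_nonzero[OF rho_nonzero, of n] power_rho_rho_inv[of n] by (auto simp: mult.commute)
  moreover have "x \<noteq> 0" if "1 \<preceq> x * \<rho> ^ n" for n
    using that by (auto simp: char_le_def)
  ultimately show ?thesis unfolding E_def bounded_part_def by auto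
qed

lemma E_nonzero: "x \<in> E \<Longrightarrow> x \<noteq> 0" by (simp add: E_def)

lemma E_bound: assumes "x \<in> E" obtains n where "\<And>m. n \<le> m \<Longrightarrow> 1 \<preceq> x * \<rho> ^ m \<and> x \<preceq> \<rho> ^ m"
proof -
  obtain n where "1 \<preceq> x * \<rho> ^ n" "x \<preceq> \<rho> ^ n"
    using assms unfolding E_iff by blast
  then show thesis
    using cle_trans[OF _ cle_mult_mono[OF cle_refl rho_power_mono]] cle_trans[OF _ rho_power_mono]
    by (intro that[of n]) auto
qed

lemma E_mult: assumes "x \<in> E" "y \<in> E" shows "x * y \<in> E"
proof -
  obtain m n where m: "1 \<preceq> x * \<rho> ^ m \<and> x \<preceq> \<rho> ^ m" and n: "1 \<preceq> y * \<rho> ^ n \<and> y \<preceq> \<rho> ^ n"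
    using assms unfolding E_iff by blast
  then have "1 * 1 \<preceq> (x * \<rho> ^ m) * (y * \<rho> ^ n)" "x * y \<preceq> \<rho> ^ m * \<rho> ^ n"
    by (blast intro: cle_mult_mono)+
  then show ?thesis unfolding E_iff by (intro exI[of _ "m + n"]) (simp add: power_add ac_simps)
qed

lemma E_add: assumes "x \<in> E" "y \<in> E" shows "x + y \<in> E"
proof -
  obtain m n where m: "\<And>k. m \<le> k \<Longrightarrow> 1 \<preceq> x * \<rho> ^ k \<and> x \<preceq> \<rho> ^ k"
    and n: "\<And>k. n \<le> k \<Longrightarrow> 1 \<preceq> y * \<rho> ^ k \<and> y \<preceq> \<rho> ^ k"
    using assms E_bound by metis
  have "1 \<preceq> (x + y) * \<rho> ^ (m + n)"
    using m[of "m + n"] cle_trans[OF _ cle_mult_right_mono[OF cle_add1]] by auto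
  then show ?thesis unfolding E_iff using m[of "m + n"] n[of "m + n"] by (auto intro: add_least)
qed

lemma E_one: "1 \<in> E" unfolding E_iff by (intro exI[of _ 0]) (simp add: cle_refl)

lemma E_rho: "\<rho> \<in> E" unfolding E_iff
  by (intro exI[of _ 1]) (use cle_mult_mono[OF rho_ge_1 rho_ge_1] in \<open>auto simp: cle_refl\<close>)

lemma E_rho_inv: "rho_inv \<in> E" unfolding E_iff
proof (intro exI[of _ 1] conjI)
  show "rho_inv \<preceq> \<rho> ^ 1"
    using cle_mult_right_mono[OF rho_ge_1, of rho_inv] rho_ge_1 cle_trans rho_rho_inv by simp
qed (simp add: rho_inv_rho cle_refl)

lemma E_power: "x \<in> E \<Longrightarrow> x ^ n \<in> E"
  by (induction n) (auto intro: E_mult E_one)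

lemma E_qpow: assumes "x \<in> E" "0 < \<alpha>" shows "qpow \<alpha> x \<in> E"
proof -
  obtain a b :: nat where ab: "0 < a" "0 < b" "\<alpha> = of_nat a / of_nat b"
    using pos_rat_cases[OF assms(2)] .
  have pow: "qpow \<alpha> x ^ b = x ^ a" using qpow_power ab by simp
  obtain m where m: "1 \<preceq> x ^ a * \<rho> ^ m" "x ^ a \<preceq> \<rho> ^ m"
    using E_power[OF assms(1)] unfolding E_iff by blast
  have "\<rho> ^ m \<preceq> (\<rho> ^ m) ^ b" using ab(2) by (metis power_mult rho_power_mono cle_add1 mult.commute
    mult_le_mono2 nat_mult_1_right Suc_leI One_nat_def)
  then have "1 ^ b \<preceq> (qpow \<alpha> x * \<rho> ^ m) ^ b" "qpow \<alpha> x ^ b \<preceq> (\<rho> ^ m) ^ b"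
    using m cle_trans cle_mult_mono[OF cle_refl] by (auto simp: power_mult_distrib pow)
  then show ?thesis unfolding E_iff power_cle_iff[OF ab(2)] by blast
qed

section \<open>Total preorders extending the canonical order\<close>

text \<open>Identifying elements that are below each other gives a semi-ring of characteristic one, with
  canonical order induced by the preorder, in which nonzero elements of \<open>R\<close> can still be cancelled.\<close>
definition congr_preorder :: "('a \<times> 'a) set \<Rightarrow> bool" where
  "congr_preorder r \<longleftrightarrow>
    (\<forall>x y. x \<preceq> y \<longrightarrow> (x, y) \<in> r) \<and>
    (\<forall>x y z. (x, y) \<in> r \<longrightarrow> (y, z) \<in> r \<longrightarrow> (x, z) \<in> r) \<and>
    (\<forall>x y z. (x, y) \<in> r \<longrightarrow> (x * z, y * z) \<in> r) \<and>
    (\<forall>x y z. (x, z) \<in> r \<longrightarrow> (y, z) \<in> r \<longrightarrow> (x + y, z) \<in> r) \<and>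
    (\<forall>x y z. z \<noteq> 0 \<longrightarrow> (x * z, y * z) \<in> r \<longrightarrow> (x, y) \<in> r)"

lemma congr_preorderD:
  assumes "congr_preorder r"
  shows "x \<preceq> y \<Longrightarrow> (x, y) \<in> r"
    and "(x, y) \<in> r \<Longrightarrow> (y, z) \<in> r \<Longrightarrow> (x, z) \<in> r"
    and "(x, y) \<in> r \<Longrightarrow> (x * z, y * z) \<in> r"
    and "(x, z) \<in> r \<Longrightarrow> (y, z) \<in> r \<Longrightarrow> (x + y, z) \<in> r"
    and "z \<noteq> 0 \<Longrightarrow> (x * z, y * z) \<in> r \<Longrightarrow> (x, y) \<in> r"
proof -
  note r = assms[unfolded congr_preorder_def]
  show "x \<preceq> y \<Longrightarrow> (x, y) \<in> r" by (rule r[THEN conjunct1, rule_format])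
  show "(x, y) \<in> r \<Longrightarrow> (y, z) \<in> r \<Longrightarrow> (x, z) \<in> r"
    by (rule r[THEN conjunct2, THEN conjunct1, rule_format])
  show "(x, y) \<in> r \<Longrightarrow> (x * z, y * z) \<in> r"
    by (rule r[THEN conjunct2, THEN conjunct2, THEN conjunct1, rule_format])
  show "(x, z) \<in> r \<Longrightarrow> (y, z) \<in> r \<Longrightarrow> (x + y, z) \<in> r"
    by (rule r[THEN conjunct2, THEN conjunct2, THEN conjunct2, THEN conjunct1, rule_format])
  show "z \<noteq> 0 \<Longrightarrow> (x * z, y * z) \<in> r \<Longrightarrow> (x, y) \<in> r"
    by (rule r[THEN conjunct2, THEN conjunct2, THEN conjunct2, THEN conjunct2, rule_format])
qed

lemma congr_preorder_le: "congr_preorder {(x, y). x \<preceq> y}"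
  unfolding congr_preorder_def
  by (auto intro: cle_mult_right_mono add_least mult_cle_cancel cle_trans)

text \<open>The extension of \<open>r\<close> that forces \<open>p\<close> below \<open>q\<close>.  In the additive notation of lattice-ordered
  groups, \<open>s \<le> t\<close> modulo \<open>p \<le> q\<close> means \<open>s \<le> t + n (p - q)\<^sup>+\<close> for some \<open>n\<close>, and
  \<open>(p - q)\<^sup>+ = max p q - q\<close>; the definition is this inequality with the subtraction cleared.\<close>
definition adjoin :: "('a \<times> 'a) set \<Rightarrow> 'a \<Rightarrow> 'a \<Rightarrow> ('a \<times> 'a) set" where
  "adjoin r p q = {(s, t). \<exists>n. (s * q ^ n, t * (p + q) ^ n) \<in> r}"

lemma adjoin_raise:
  assumes r: "congr_preorder r" and st: "(s * q ^ n, t * (p + q) ^ n) \<in> r" and "n \<le> m"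
  shows "(s * q ^ m, t * (p + q) ^ m) \<in> r"
proof -
  obtain k where m: "m = n + k" using \<open>n \<le> m\<close> le_Suc_ex by blast
  have "t * (p + q) ^ n * q ^ k \<preceq> t * (p + q) ^ n * (p + q) ^ k"
    by (intro cle_mult_mono cle_refl cle_power_mono cle_add2)
  then show ?thesis
    using congr_preorderD(3)[OF r st, of "q ^ k"] congr_preorderD(1,2)[OF r]
    unfolding m power_add mult.assoc by blast
qed

lemma congr_preorder_adjoin:
  assumes r: "congr_preorder r"
  shows "congr_preorder (adjoin r p q)" "r \<subseteq> adjoin r p q" "(p, q) \<in> adjoin r p q"
proof -
  note D = congr_preorderD[OF r]
  show sub: "r \<subseteq> adjoin r p q"
  proof clarify
    fix x y assume "(x, y) \<in> r"
    then have "(x * q ^ 0, y * (p + q) ^ 0) \<in> r" by simp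
    then show "(x, y) \<in> adjoin r p q" unfolding adjoin_def by blast
  qed
  have "(p * q ^ 1, q * (p + q) ^ 1) \<in> r"
    using cle_mult_mono[OF cle_add1[of p q] cle_refl[of q]] by (intro D(1)) (simp add: mult.commute)
  then show "(p, q) \<in> adjoin r p q" unfolding adjoin_def by blast
  show "congr_preorder (adjoin r p q)"
    unfolding congr_preorder_def
  proof (intro conjI allI impI)
    fix x y :: 'a assume "x \<preceq> y" then show "(x, y) \<in> adjoin r p q" using sub D(1) by blast
  next
    fix x y z assume "(x, y) \<in> adjoin r p q" "(y, z) \<in> adjoin r p q"
    then obtain n m where nm: "(x * q ^ n, y * (p + q) ^ n) \<in> r" "(y * q ^ m, z * (p + q) ^ m) \<in> r"
      unfolding adjoin_def by blast
    have "(x * q ^ n * q ^ m, y * (p + q) ^ n * q ^ m) \<in> r" by (rule D(3)[OF nm(1)])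
    moreover have "(y * q ^ m * (p + q) ^ n, z * (p + q) ^ m * (p + q) ^ n) \<in> r"
      by (rule D(3)[OF nm(2)])
    ultimately have "(x * q ^ (n + m), z * (p + q) ^ (n + m)) \<in> r"
      using D(2) by (simp add: power_add ac_simps)
    then show "(x, z) \<in> adjoin r p q" unfolding adjoin_def by blast
  next
    fix x y z assume "(x, y) \<in> adjoin r p q"
    then obtain n where "(x * q ^ n, y * (p + q) ^ n) \<in> r" unfolding adjoin_def by blast
    from D(3)[OF this, of z] show "(x * z, y * z) \<in> adjoin r p q"
      unfolding adjoin_def by (auto simp: ac_simps)
  next
    fix x y z assume "(x, z) \<in> adjoin r p q" "(y, z) \<in> adjoin r p q"
    then obtain n m where "(x * q ^ n, z * (p + q) ^ n) \<in> r" "(y * q ^ m, z * (p + q) ^ m) \<in> r"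
      unfolding adjoin_def by blast
    then have "(x * q ^ (n + m), z * (p + q) ^ (n + m)) \<in> r"
      "(y * q ^ (n + m), z * (p + q) ^ (n + m)) \<in> r"
      by (auto intro: adjoin_raise[OF r])
    from D(4)[OF this] show "(x + y, z) \<in> adjoin r p q"
      unfolding adjoin_def by (auto simp flip: distrib_right)
  next
    fix x y z :: 'a assume z: "z \<noteq> 0" and "(x * z, y * z) \<in> adjoin r p q"
    then obtain n where "(x * z * q ^ n, y * z * (p + q) ^ n) \<in> r" unfolding adjoin_def by blast
    then have "(x * q ^ n, y * (p + q) ^ n) \<in> r"
      using D(5)[OF z, of "x * q ^ n" "y * (p + q) ^ n"] by (simp add: ac_simps)
    then show "(x, y) \<in> adjoin r p q" unfolding adjoin_def by blast
  qed
qed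

text \<open>The positive parts of \<open>p - q\<close> and \<open>q - p\<close> are disjoint, so the two extensions have nothing new
  in common.  Adding the hypotheses at a common exponent gives \<open>a (p ^ k + q ^ k) \<le> b (p + q) ^ k\<close>,
  where the factors \<open>p ^ k + q ^ k\<close> and \<open>(p + q) ^ k\<close> agree and can be cancelled.\<close>
lemma adjoin_both:
  assumes r: "congr_preorder r" and "(a, b) \<in> adjoin r p q" "(a, b) \<in> adjoin r q p"
    and "p + q \<noteq> 0"
  shows "(a, b) \<in> r"
proof -
  note D = congr_preorderD[OF r]
  obtain m n where "(a * q ^ m, b * (p + q) ^ m) \<in> r" "(a * p ^ n, b * (q + p) ^ n) \<in> r"
    using assms(2,3) unfolding adjoin_def by blast
  then have "(a * q ^ (m + n), b * (p + q) ^ (m + n)) \<in> r" "(a * p ^ (m + n), b * (p + q) ^ (m + n)) \<in> r"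
    using adjoin_raise[OF r, of a q m b p "m + n"] adjoin_raise[OF r, of a p n b q "m + n"]
    by (simp_all add: add.commute)
  then have "(a * (p + q) ^ (m + n), b * (p + q) ^ (m + n)) \<in> r"
    unfolding power_add_eq distrib_left by (rule D(4)[rotated])
  then show ?thesis using D(5) assms(4) power_nonzero by blast
qed

text \<open>Zorn's lemma for the preorders in which \<open>a\<close> is not below \<open>b\<close>; by \<open>adjoin_both\<close> a maximal one
  coincides with its extension by \<open>p \<le> q\<close> or with that by \<open>q \<le> p\<close>.\<close>
lemma total_congr_preorder_exists:
  assumes "\<not> a \<preceq> b"
  obtains r where "congr_preorder r" "(a, b) \<notin> r" "\<And>x y. (x, y) \<in> r \<or> (y, x) \<in> r"
proof -
  let ?A = "{r. congr_preorder r \<and> (a, b) \<notin> r}"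
  have "\<exists>M\<in>?A. \<forall>r\<in>?A. M \<subseteq> r \<longrightarrow> r = M"
  proof (rule subset_Zorn_nonempty)
    have "{(x, y). x \<preceq> y} \<in> ?A" using congr_preorder_le assms by simp
    then show "?A \<noteq> {}" by auto
    fix C assume C: "C \<noteq> {}" "subset.chain ?A C"
    then have sub: "C \<subseteq> ?A" and lin: "\<forall>r\<in>C. \<forall>s\<in>C. r \<subseteq> s \<or> s \<subseteq> r"
      by (simp_all add: subset_chain_def)
    have common: "\<exists>r\<in>C. p \<in> r \<and> q \<in> r" if pq: "p \<in> \<Union>C" "q \<in> \<Union>C" for p q
    proof -
      obtain r s where "r \<in> C" "p \<in> r" "s \<in> C" "q \<in> s" using pq by (elim UnionE)
      with lin[rule_format, of r s] show ?thesis by auto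
    qed
    have D: "congr_preorder r" if "r \<in> C" for r using subsetD[OF sub that] by simp
    have "congr_preorder (\<Union>C)"
      unfolding congr_preorder_def
    proof (intro conjI allI impI)
      fix x y :: 'a assume "x \<preceq> y"
      obtain r where "r \<in> C" using C(1) by auto
      with congr_preorderD(1)[OF D \<open>x \<preceq> y\<close>] show "(x, y) \<in> \<Union>C" by (intro UnionI[of r])
    next
      fix x y z assume "(x, y) \<in> \<Union>C" "(y, z) \<in> \<Union>C"
      from common[OF this] obtain r where "r \<in> C" "(x, y) \<in> r" "(y, z) \<in> r" by auto
      then show "(x, z) \<in> \<Union>C" using congr_preorderD(2)[OF D] by (intro UnionI[of r])
    next
      fix x y z assume "(x, y) \<in> \<Union>C"
      then obtain r where "r \<in> C" "(x, y) \<in> r" by (elim UnionE)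
      then show "(x * z, y * z) \<in> \<Union>C" using congr_preorderD(3)[OF D] by (intro UnionI[of r])
    next
      fix x y z assume "(x, z) \<in> \<Union>C" "(y, z) \<in> \<Union>C"
      from common[OF this] obtain r where "r \<in> C" "(x, z) \<in> r" "(y, z) \<in> r" by auto
      then show "(x + y, z) \<in> \<Union>C" using congr_preorderD(4)[OF D] by (intro UnionI[of r])
    next
      fix x y z :: 'a assume z: "z \<noteq> 0" and "(x * z, y * z) \<in> \<Union>C"
      then obtain r where "r \<in> C" "(x * z, y * z) \<in> r" by (elim UnionE)
      then show "(x, y) \<in> \<Union>C" using congr_preorderD(5)[OF D z] by (intro UnionI[of r])
    qed
    moreover have "(a, b) \<notin> \<Union>C" using sub by auto
    ultimately show "\<Union>C \<in> ?A" by simp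
  qed
  then obtain M where M: "congr_preorder M" "(a, b) \<notin> M"
    and max: "\<And>r. congr_preorder r \<Longrightarrow> (a, b) \<notin> r \<Longrightarrow> M \<subseteq> r \<Longrightarrow> r = M" by auto
  have "(p, q) \<in> M \<or> (q, p) \<in> M" for p q
  proof (cases "p + q = 0")
    case True
    then have "p \<preceq> q" using zero_cle add_eq_0D(1) by metis
    then show ?thesis using congr_preorderD(1)[OF M(1)] by blast
  next
    case False
    then have "(a, b) \<notin> adjoin M p q \<or> (a, b) \<notin> adjoin M q p"
      using adjoin_both[OF M(1)] M(2) by blast
    then have "adjoin M p q = M \<or> adjoin M q p = M"
      using max[OF congr_preorder_adjoin(1)[OF M(1)] _ congr_preorder_adjoin(2)[OF M(1)]] by blast
    then show ?thesis using congr_preorder_adjoin(3)[OF M(1)] by metis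
  qed
  then show thesis using that M by blast
qed

section \<open>Characters\<close>

text \<open>Outside \<open>E\<close> a character is an arbitrary function, so one homomorphism on \<open>E\<close> is represented
  many times; the functions on \<open>characters\<close> considered below agree on all its representatives.\<close>
definition characters :: "('a \<Rightarrow> real) set" where
  "characters = {\<phi>. \<phi> \<rho> = 1 \<and>
    (\<forall>x\<in>E. \<forall>y\<in>E. \<phi> (x * y) = \<phi> x + \<phi> y \<and> \<phi> (x + y) = max (\<phi> x) (\<phi> y))}"

text \<open>The infimum of the rationals \<open>q\<close> with \<open>z \<le> \<rho>\<^sup>q\<close> in \<open>r\<close>; writing \<open>q = (m - k) / n\<close> clears the
  inequality of denominators and of negative exponents.\<close>
definition cut :: "('a \<times> 'a) set \<Rightarrow> 'a \<Rightarrow> real" where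
  "cut r z = Inf {(real m - real k) / real n | m k n. 0 < n \<and> (z ^ n * \<rho> ^ k, \<rho> ^ m) \<in> r}"

lemma congr_preorder_power:
  assumes r: "congr_preorder r" and "(x, y) \<in> r" shows "(x ^ n, y ^ n) \<in> r"
proof (induction n)
  case (Suc n)
  have "(x * x ^ n, y * x ^ n) \<in> r" using assms congr_preorderD(3) by blast
  moreover have "(x ^ n * y, y ^ n * y) \<in> r" using Suc congr_preorderD(3)[OF r] by blast
  ultimately show ?case using congr_preorderD(2)[OF r] by (simp add: mult.commute)
qed (use congr_preorderD(1)[OF r] cle_refl in auto)

text \<open>Otherwise \<open>\<rho>\<close> would be equivalent to \<open>1\<close>, and then all of \<open>E\<close> would be, because its elements
  lie between powers of \<open>\<rho>\<close>; this is excluded by one pair from \<open>E\<close> that is not in \<open>r\<close>.\<close>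
lemma rho_power_reflect:
  assumes r: "congr_preorder r" "(a, b) \<notin> r" "a \<in> E" "b \<in> E" and ij: "(\<rho> ^ i, \<rho> ^ j) \<in> r"
  shows "i \<le> j"
proof (rule ccontr)
  note D = congr_preorderD[OF r(1)]
  assume "\<not> i \<le> j"
  then obtain k where k: "i = Suc k + j" by (metis add.commute less_iff_Suc_add not_le add_Suc)
  have "(\<rho> ^ Suc k * \<rho> ^ j, 1 * \<rho> ^ j) \<in> r" using ij unfolding k power_add by simp
  then have "(\<rho> ^ Suc k, 1) \<in> r" using D(5) power_nonzero rho_nonzero by blast
  moreover have "\<rho> \<preceq> \<rho> ^ Suc k" using rho_power_mono[of 1 "Suc k"] by simp
  ultimately have "(\<rho>, 1) \<in> r" using D(1,2) by blast
  then have pow: "(\<rho> ^ n, 1) \<in> r" for n using congr_preorder_power[OF r(1), of \<rho> 1 n] by simp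
  obtain m where m: "a \<preceq> \<rho> ^ m" using \<open>a \<in> E\<close> E_iff by blast
  obtain n where n: "1 \<preceq> b * \<rho> ^ n" using \<open>b \<in> E\<close> E_iff by blast
  have "(a, 1) \<in> r" using m pow D(1,2) by blast
  moreover have "(1, b) \<in> r" using D(3)[OF pow[of n], of b] n D(1,2) by (simp add: mult.commute) blast
  ultimately show False using r(2) D(2) by blast
qed

context
  fixes r a b
  assumes r: "congr_preorder r" and ab: "(a, b) \<notin> r" "a \<in> E" "b \<in> E"
    and total: "\<And>x y. (x, y) \<in> r \<or> (y, x) \<in> r"
begin

lemmas congr_r = congr_preorderD[OF r]

lemma refl_r: "(x, x) \<in> r" using congr_r(1) cle_refl by blast

lemma cut_bounds_compare:
  assumes lo: "(\<rho> ^ m, z ^ n * \<rho> ^ k) \<in> r" and up: "(z ^ N * \<rho> ^ K, \<rho> ^ M) \<in> r" and n: "0 < n" "0 < N"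
  shows "(real m - real k) / real n \<le> (real M - real K) / real N"
proof -
  have "((\<rho> ^ m) ^ N * \<rho> ^ (K * n), (z ^ n * \<rho> ^ k) ^ N * \<rho> ^ (K * n)) \<in> r"
    by (intro congr_r(3) congr_preorder_power r lo)
  moreover have "((z ^ N * \<rho> ^ K) ^ n * \<rho> ^ (k * N), (\<rho> ^ M) ^ n * \<rho> ^ (k * N)) \<in> r"
    by (intro congr_r(3) congr_preorder_power r up)
  moreover have "(z ^ n * \<rho> ^ k) ^ N * \<rho> ^ (K * n) = (z ^ N * \<rho> ^ K) ^ n * \<rho> ^ (k * N)"
    by (simp add: power_mult_distrib ac_simps flip: power_mult)
  ultimately have "(\<rho> ^ (m * N + K * n), \<rho> ^ (M * n + k * N)) \<in> r"
    using congr_r(2) by (simp add: power_add flip: power_mult)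
  then have "m * N + K * n \<le> M * n + k * N"
    by (rule rho_power_reflect[OF r ab])
  then have "real (m * N + K * n) \<le> real (M * n + k * N)"
    by (simp only: of_nat_le_iff)
  then have "(real m - real k) * real N \<le> (real M - real K) * real n"
    by (simp add: algebra_simps)
  then show ?thesis using n by (simp add: field_simps)
qed

text \<open>By totality each \<open>z ^ n\<close> lies between consecutive powers of \<open>\<rho>\<close>, so \<open>cut r z\<close> is determined up
  to \<open>1 / n\<close>.  Additivity and monotonicity of \<open>cut r\<close> follow by letting \<open>n\<close> grow.\<close>
lemma rho_approximation:
  assumes "z \<in> E"
  obtains m k where "(\<rho> ^ m, z ^ n * \<rho> ^ k) \<in> r" "(z ^ n * \<rho> ^ k, \<rho> ^ (m + 1)) \<in> r"
proof -
  obtain k where k: "1 \<preceq> z ^ n * \<rho> ^ k" using E_power[OF assms] E_iff by blast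
  let ?w = "z ^ n * \<rho> ^ k"
  have "?w \<in> E" using assms E_power E_mult E_rho by blast
  then obtain M where M: "?w \<preceq> \<rho> ^ M" using E_iff by blast
  let ?S = "{m. (\<rho> ^ m, ?w) \<in> r}"
  have "m \<le> M" if "m \<in> ?S" for m
    using that rho_power_reflect[OF r ab, of m M] congr_r(1)[OF M] congr_r(2) by blast
  then have fin: "finite ?S" using finite_nat_set_iff_bounded_le by blast
  have "0 \<in> ?S" using k congr_r(1) by simp
  then have "Max ?S \<in> ?S" using Max_in[OF fin] by blast
  moreover have "Max ?S + 1 \<notin> ?S" using Max_ge[OF fin, of "Max ?S + 1"] by linarith
  ultimately show thesis using that total by blast
qed

lemma cut_le:
  assumes "z \<in> E" "0 < n" "(z ^ n * \<rho> ^ k, \<rho> ^ m) \<in> r" shows "cut r z \<le> (real m - real k) / real n"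
proof -
  obtain m' k' where "(\<rho> ^ m', z ^ 1 * \<rho> ^ k') \<in> r" using rho_approximation[OF assms(1)] by metis
  then have "(real m' - real k') / real 1 \<le> s"
    if "s \<in> {(real m - real k) / real n | m k n. 0 < n \<and> (z ^ n * \<rho> ^ k, \<rho> ^ m) \<in> r}" for s
    using that cut_bounds_compare[where n = 1] by auto
  then show ?thesis unfolding cut_def
    using assms by (intro cInf_lower bdd_belowI[of _ "(real m' - real k') / real 1"]) blast
qed

lemma le_cut:
  assumes "z \<in> E" "0 < n" "(\<rho> ^ m, z ^ n * \<rho> ^ k) \<in> r" shows "(real m - real k) / real n \<le> cut r z"
proof -
  obtain m' k' where "(z ^ 1 * \<rho> ^ k', \<rho> ^ (m' + 1)) \<in> r" using rho_approximation[OF assms(1)] by metis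
  then have "{(real m - real k) / real n | m k n. 0 < n \<and> (z ^ n * \<rho> ^ k, \<rho> ^ m) \<in> r} \<noteq> {}"
    using zero_less_one by blast
  then show ?thesis unfolding cut_def
    by (rule cInf_greatest) (use assms cut_bounds_compare in auto)
qed

lemma cut_mult: assumes "x \<in> E" "y \<in> E" shows "cut r (x * y) = cut r x + cut r y"
proof -
  have "\<bar>cut r (x * y) - (cut r x + cut r y)\<bar> \<le> 2 / real n" if n: "0 < n" for n
  proof -
    obtain m k where x: "(\<rho> ^ m, x ^ n * \<rho> ^ k) \<in> r" "(x ^ n * \<rho> ^ k, \<rho> ^ (m + 1)) \<in> r"
      using rho_approximation[OF assms(1)] .
    obtain m' k' where y: "(\<rho> ^ m', y ^ n * \<rho> ^ k') \<in> r" "(y ^ n * \<rho> ^ k', \<rho> ^ (m' + 1)) \<in> r"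
      using rho_approximation[OF assms(2)] .
    have mult: "(s * s', t * t') \<in> r" if "(s, t) \<in> r" "(s', t') \<in> r" for s s' t t'
      using congr_r(3)[OF that(1), of s'] congr_r(3)[OF that(2), of t] congr_r(2) by (simp add: mult.commute)
    have "(\<rho> ^ (m + m'), (x * y) ^ n * \<rho> ^ (k + k')) \<in> r"
      using mult[OF x(1) y(1)] by (simp add: power_add power_mult_distrib ac_simps)
    then have 1: "(real (m + m') - real (k + k')) / real n \<le> cut r (x * y)"
      using le_cut E_mult assms n by blast
    have "((x * y) ^ n * \<rho> ^ (k + k'), \<rho> ^ (m + m' + 2)) \<in> r"
      using mult[OF x(2) y(2)] by (simp add: power_add power_mult_distrib ac_simps power2_eq_square)
    then have 2: "cut r (x * y) \<le> (real (m + m' + 2) - real (k + k')) / real n"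
      using cut_le E_mult assms n by blast
    show ?thesis
      using 1 2 le_cut[OF assms(1) n x(1)] cut_le[OF assms(1) n x(2)]
        le_cut[OF assms(2) n y(1)] cut_le[OF assms(2) n y(2)]
      by (simp add: diff_divide_distrib add_divide_distrib)
  qed
  then have "\<bar>cut r (x * y) - (cut r x + cut r y)\<bar> \<le> 0"
    by (intro tendsto_lowerbound[OF lim_const_over_n[of 2]]) (auto intro!: eventually_sequentiallyI[of 1])
  then show ?thesis by simp
qed

lemma cut_mono: assumes "x \<in> E" "y \<in> E" "(x, y) \<in> r" shows "cut r x \<le> cut r y"
proof -
  have "cut r x - cut r y \<le> 1 / real n" if n: "0 < n" for n
  proof -
    obtain m k where y: "(\<rho> ^ m, y ^ n * \<rho> ^ k) \<in> r" "(y ^ n * \<rho> ^ k, \<rho> ^ (m + 1)) \<in> r"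
      using rho_approximation[OF assms(2)] .
    have "(x ^ n * \<rho> ^ k, \<rho> ^ (m + 1)) \<in> r"
      using congr_r(2)[OF congr_r(3)[OF congr_preorder_power[OF r assms(3)]] y(2)] .
    from cut_le[OF assms(1) n this] le_cut[OF assms(2) n y(1)] show ?thesis
      by (simp add: diff_divide_distrib add_divide_distrib)
  qed
  then have "cut r x - cut r y \<le> 0"
    by (intro tendsto_lowerbound[OF lim_const_over_n[of 1]]) (auto intro!: eventually_sequentiallyI[of 1])
  then show ?thesis by simp
qed

lemma cut_character: "cut r \<in> characters"
  unfolding characters_def
proof (intro CollectI conjI ballI)
  show "cut r \<rho> = 1"
    using cut_le[OF E_rho, of 1 0 1] le_cut[OF E_rho, of 1 1 0] refl_r by simp
next
  fix x y assume xy: "x \<in> E" "y \<in> E"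
  show "cut r (x * y) = cut r x + cut r y" by (rule cut_mult[OF xy])
  have ge: "cut r x \<le> cut r (x + y)" "cut r y \<le> cut r (x + y)"
    using xy by (auto intro!: cut_mono E_add congr_r(1) cle_add1 cle_add2)
  have "cut r (x + y) \<le> cut r x \<or> cut r (x + y) \<le> cut r y"
    using total[of x y] congr_r(4)[of x y y] congr_r(4)[of x x y] refl_r cut_mono[OF E_add] xy by blast
  then show "cut r (x + y) = max (cut r x) (cut r y)" using ge by linarith
qed

lemma cut_separates: "cut r b \<le> cut r a"
  using cut_mono total ab by blast

end

theorem character_separation:
  assumes "x \<in> E" "y \<in> E" "\<not> x \<preceq> y"
  obtains \<phi> where "\<phi> \<in> characters" "\<phi> y \<le> \<phi> x"
  using total_congr_preorder_exists[OF assms(3)] cut_character cut_separates assms(1,2) by metis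

lemma characters_nonempty: "characters \<noteq> {}"
proof -
  have "\<not> \<rho> \<preceq> 1" using rho_ge_1 rho_neq_1 cle_antisym by blast
  then show ?thesis using character_separation[OF E_rho E_one] by blast
qed

lemma
  assumes "\<phi> \<in> characters"
  shows char_rho: "\<phi> \<rho> = 1"
    and char_mult: "x \<in> E \<Longrightarrow> y \<in> E \<Longrightarrow> \<phi> (x * y) = \<phi> x + \<phi> y"
    and char_add: "x \<in> E \<Longrightarrow> y \<in> E \<Longrightarrow> \<phi> (x + y) = max (\<phi> x) (\<phi> y)"
  using assms unfolding characters_def by blast+

lemma char_1: "\<phi> \<in> characters \<Longrightarrow> \<phi> 1 = 0"
  using char_mult[OF _ E_one E_one] by fastforce

lemma char_rho_inv: "\<phi> \<in> characters \<Longrightarrow> \<phi> rho_inv = -1"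
  using char_mult[OF _ E_rho E_rho_inv] char_1 char_rho by (fastforce simp: rho_rho_inv)

lemma char_mono: "\<phi> \<in> characters \<Longrightarrow> x \<in> E \<Longrightarrow> y \<in> E \<Longrightarrow> x \<preceq> y \<Longrightarrow> \<phi> x \<le> \<phi> y"
  using char_add[of \<phi> x y] by (simp add: char_le_def)

lemma char_power: "\<phi> \<in> characters \<Longrightarrow> x \<in> E \<Longrightarrow> \<phi> (x ^ n) = real n * \<phi> x"
  by (induction n) (auto simp: char_1 char_mult E_power algebra_simps)

lemma char_qpow:
  assumes "\<phi> \<in> characters" "x \<in> E" "0 < \<alpha>" shows "\<phi> (qpow \<alpha> x) = real_of_rat \<alpha> * \<phi> x"
proof -
  obtain a b :: nat where ab: "0 < a" "0 < b" "\<alpha> = of_nat a / of_nat b"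
    using pos_rat_cases[OF assms(3)] .
  have "\<phi> (qpow \<alpha> x ^ b) = \<phi> (x ^ a)" using qpow_power ab by simp
  then have "real b * \<phi> (qpow \<alpha> x) = real a * \<phi> x"
    using char_power assms E_qpow by simp
  then have "\<phi> (qpow \<alpha> x) = real a / real b * \<phi> x" using ab(2) by (simp add: field_simps)
  then show ?thesis unfolding ab(3) of_rat_divide by simp
qed

lemma char_bounded: assumes "x \<in> E" obtains M where "\<And>\<phi>. \<phi> \<in> characters \<Longrightarrow> \<bar>\<phi> x\<bar> \<le> M"
proof -
  obtain n where n: "1 \<preceq> x * \<rho> ^ n" "x \<preceq> \<rho> ^ n" using assms E_iff by blast
  have "\<bar>\<phi> x\<bar> \<le> real n" if "\<phi> \<in> characters" for \<phi>
    using char_mono[OF that E_one _ n(1)] char_mono[OF that assms _ n(2)] that assms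
    by (simp add: E_mult E_power E_rho char_mult char_power char_rho char_1)
  then show thesis using that by blast
qed

text \<open>If \<open>x \<preceq> y * \<rho>\<^sup>\<alpha>\<close> fails, a separating
  character has \<open>\<phi> y + \<alpha> \<le> \<phi> x\<close>, so no \<open>\<alpha>\<close> beyond the sup distance is excluded from the infimum.
  Such an \<open>\<alpha>\<close> is positive because there is a character, so that the sup distance is not negative.\<close>
lemma pdist_le_iff:
  assumes xy: "x \<in> E" "y \<in> E"
  shows "pdist \<rho> x y \<le> e \<longleftrightarrow> (\<forall>\<phi>\<in>characters. \<bar>\<phi> x - \<phi> y\<bar> \<le> e)"
proof -
  let ?S = "{real_of_rat \<alpha> | \<alpha>. 0 < \<alpha> \<and> x \<preceq> y * qpow \<alpha> \<rho> \<and> y \<preceq> x * qpow \<alpha> \<rho>}"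
  have mem: "z * qpow \<alpha> \<rho> \<in> E" if "z \<in> E" "0 < \<alpha>" for z \<alpha> using that by (intro E_mult E_qpow E_rho)
  have char: "\<phi> (z * qpow \<alpha> \<rho>) = \<phi> z + real_of_rat \<alpha>" if "\<phi> \<in> characters" "z \<in> E" "0 < \<alpha>" for \<phi> z \<alpha>
    using that by (simp add: char_mult char_qpow E_qpow E_rho char_rho)
  have lower: "\<bar>\<phi> x - \<phi> y\<bar> \<le> s" if "s \<in> ?S" "\<phi> \<in> characters" for s \<phi>
    using that char_mono[OF that(2) xy(1) mem[OF xy(2)]] char_mono[OF that(2) xy(2) mem[OF xy(1)]]
      char[OF that(2)] xy by fastforce
  have upper: "real_of_rat \<alpha> \<in> ?S"
    if e: "\<And>\<phi>. \<phi> \<in> characters \<Longrightarrow> \<bar>\<phi> x - \<phi> y\<bar> \<le> e'" "e' < real_of_rat \<alpha>" for \<alpha> e'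
  proof -
    obtain \<phi> where "\<phi> \<in> characters" using characters_nonempty by blast
    from e(1)[OF this] e(2) have "0 < real_of_rat \<alpha>" by linarith
    then have "0 < \<alpha>" by simp
    have "z \<preceq> t * qpow \<alpha> \<rho>" if zt: "z \<in> E" "t \<in> E" "\<And>\<phi>. \<phi> \<in> characters \<Longrightarrow> \<bar>\<phi> z - \<phi> t\<bar> \<le> e'" for z t
    proof (rule ccontr)
      assume "\<not> z \<preceq> t * qpow \<alpha> \<rho>"
      then obtain \<phi> where "\<phi> \<in> characters" "\<phi> (t * qpow \<alpha> \<rho>) \<le> \<phi> z"
        using character_separation zt mem \<open>0 < \<alpha>\<close> by metis
      with char zt(2) zt(3)[of \<phi>] e(2) \<open>0 < \<alpha>\<close> show False by fastforce
    qed
    from this[of x y] this[of y x] xy e(1) show ?thesis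
      using \<open>0 < \<alpha>\<close> by (auto simp: abs_minus_commute)
  qed
  obtain M N where "\<And>\<phi>. \<phi> \<in> characters \<Longrightarrow> \<bar>\<phi> x\<bar> \<le> M" "\<And>\<phi>. \<phi> \<in> characters \<Longrightarrow> \<bar>\<phi> y\<bar> \<le> N"
    using char_bounded xy by metis
  then have "\<bar>\<phi> x - \<phi> y\<bar> \<le> M + N" if "\<phi> \<in> characters" for \<phi>
    using that by (smt (verit))
  then have ne: "?S \<noteq> {}" using upper[of "M + N"] by (metis empty_iff of_rat_dense less_add_one)
  obtain \<phi> where "\<phi> \<in> characters" using characters_nonempty by blast
  then have bdd: "bdd_below ?S" using lower by (intro bdd_belowI) blast
  show ?thesis
  proof
    assume le: "pdist \<rho> x y \<le> e"
    show "\<forall>\<phi>\<in>characters. \<bar>\<phi> x - \<phi> y\<bar> \<le> e"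
    proof
      fix \<phi> assume "\<phi> \<in> characters"
      then have "\<bar>\<phi> x - \<phi> y\<bar> \<le> pdist \<rho> x y" unfolding pdist_def
        using lower by (intro cInf_greatest ne)
      with le show "\<bar>\<phi> x - \<phi> y\<bar> \<le> e" by simp
    qed
  next
    assume e: "\<forall>\<phi>\<in>characters. \<bar>\<phi> x - \<phi> y\<bar> \<le> e"
    show "pdist \<rho> x y \<le> e"
    proof (rule ccontr)
      assume "\<not> pdist \<rho> x y \<le> e"
      then obtain \<alpha> where \<alpha>: "e < real_of_rat \<alpha>" "real_of_rat \<alpha> < pdist \<rho> x y"
        using of_rat_dense by (metis not_le)
      have "pdist \<rho> x y \<le> real_of_rat \<alpha>" unfolding pdist_def
        using upper e \<alpha>(1) by (intro cInf_lower bdd) blast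
      with \<alpha>(2) show False by simp
    qed
  qed
qed

section \<open>The completion as a space of functions on characters\<close>

text \<open>The uniform closure of the evaluations.  The value \<open>0\<close> off \<open>characters\<close> makes equality of functions
  the same as equality on \<open>characters\<close>.\<close>
definition limit_functions :: "(('a \<Rightarrow> real) \<Rightarrow> real) set" where
  "limit_functions = {f. (\<forall>\<phi>. \<phi> \<notin> characters \<longrightarrow> f \<phi> = 0) \<and>
     (\<forall>e>0. \<exists>x\<in>E. \<forall>\<phi>\<in>characters. \<bar>\<phi> x - f \<phi>\<bar> \<le> e)}"

text \<open>The point of the completion that corresponds to the function \<open>f\<close>.\<close>
definition limit_class :: "(('a \<Rightarrow> real) \<Rightarrow> real) \<Rightarrow> (nat \<Rightarrow> 'a) set" where
  "limit_class f = {s. (\<forall>n. s n \<in> E) \<and> uniform_limit characters (\<lambda>n \<phi>. \<phi> (s n)) f sequentially}"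

lemma limit_functions_eqI:
  assumes "f \<in> limit_functions" "g \<in> limit_functions" "\<And>\<phi>. \<phi> \<in> characters \<Longrightarrow> f \<phi> = g \<phi>"
  shows "f = g"
proof
  fix \<phi> show "f \<phi> = g \<phi>"
    using assms by (cases "\<phi> \<in> characters") (auto simp: limit_functions_def)
qed

lemma limit_functions_approx:
  assumes "f \<in> limit_functions" "0 < e"
  obtains x where "x \<in> E" "\<And>\<phi>. \<phi> \<in> characters \<Longrightarrow> \<bar>\<phi> x - f \<phi>\<bar> \<le> e"
  using assms unfolding limit_functions_def by blast

lemma limit_functionsI:
  assumes "\<And>\<phi>. \<phi> \<notin> characters \<Longrightarrow> f \<phi> = 0"
    and "\<And>e. 0 < e \<Longrightarrow> \<exists>g\<in>limit_functions. \<forall>\<phi>\<in>characters. \<bar>g \<phi> - f \<phi>\<bar> \<le> e"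
  shows "f \<in> limit_functions"
  unfolding limit_functions_def
proof (intro CollectI conjI allI impI)
  fix e :: real assume "0 < e"
  then obtain g where g: "g \<in> limit_functions" "\<And>\<phi>. \<phi> \<in> characters \<Longrightarrow> \<bar>g \<phi> - f \<phi>\<bar> \<le> e / 2"
    using assms(2)[of "e / 2"] by auto
  obtain x where x: "x \<in> E" "\<And>\<phi>. \<phi> \<in> characters \<Longrightarrow> \<bar>\<phi> x - g \<phi>\<bar> \<le> e / 2"
    using limit_functions_approx[OF g(1), of "e / 2"] \<open>0 < e\<close> by auto
  have "\<bar>\<phi> x - f \<phi>\<bar> \<le> e" if "\<phi> \<in> characters" for \<phi>
    using g(2)[OF that] x(2)[OF that] by linarith
  with x(1) show "\<exists>x\<in>E. \<forall>\<phi>\<in>characters. \<bar>\<phi> x - f \<phi>\<bar> \<le> e" by blast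
qed (use assms(1) in blast)

lemma limit_functions_bounded:
  assumes "f \<in> limit_functions" obtains M where "0 \<le> M" "\<And>\<phi>. \<bar>f \<phi>\<bar> \<le> M"
proof -
  obtain x where x: "x \<in> E" "\<And>\<phi>. \<phi> \<in> characters \<Longrightarrow> \<bar>\<phi> x - f \<phi>\<bar> \<le> 1"
    using limit_functions_approx[OF assms, of 1] by auto
  obtain M where M: "\<And>\<phi>. \<phi> \<in> characters \<Longrightarrow> \<bar>\<phi> x\<bar> \<le> M" using char_bounded[OF x(1)] by blast
  have "\<bar>f \<phi>\<bar> \<le> \<bar>M\<bar> + 1" for \<phi>
  proof (cases "\<phi> \<in> characters")
    case True then show ?thesis using x(2)[OF True] M[OF True] by linarith
  next
    case False then show ?thesis using assms by (simp add: limit_functions_def)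
  qed
  then show thesis using that[of "\<bar>M\<bar> + 1"] by simp
qed

definition eval_at :: "'a \<Rightarrow> ('a \<Rightarrow> real) \<Rightarrow> real" where
  "eval_at x \<phi> = (if \<phi> \<in> characters then \<phi> x else 0)"

lemma eval_at_limit: "x \<in> E \<Longrightarrow> eval_at x \<in> limit_functions"
  unfolding limit_functions_def eval_at_def by force

lemma limit_functions_add:
  assumes "f \<in> limit_functions" "g \<in> limit_functions"
  shows "(\<lambda>\<phi>. f \<phi> + g \<phi>) \<in> limit_functions"
proof (rule limit_functionsI)
  fix e :: real assume "0 < e"
  then obtain x y where x: "x \<in> E" "\<And>\<phi>. \<phi> \<in> characters \<Longrightarrow> \<bar>\<phi> x - f \<phi>\<bar> \<le> e / 2"
    and y: "y \<in> E" "\<And>\<phi>. \<phi> \<in> characters \<Longrightarrow> \<bar>\<phi> y - g \<phi>\<bar> \<le> e / 2"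
    using limit_functions_approx[OF assms(1), of "e / 2"] limit_functions_approx[OF assms(2), of "e / 2"]
    by (metis half_gt_zero)
  have "\<bar>eval_at (x * y) \<phi> - (f \<phi> + g \<phi>)\<bar> \<le> e" if "\<phi> \<in> characters" for \<phi>
    using x(2)[OF that] y(2)[OF that] unfolding eval_at_def if_P[OF that] char_mult[OF that x(1) y(1)]
    by linarith
  then show "\<exists>h\<in>limit_functions. \<forall>\<phi>\<in>characters. \<bar>h \<phi> - (f \<phi> + g \<phi>)\<bar> \<le> e"
    using eval_at_limit[OF E_mult[OF x(1) y(1)]] by blast
qed (use assms in \<open>simp add: limit_functions_def\<close>)

lemma limit_functions_max:
  assumes "f \<in> limit_functions" "g \<in> limit_functions"
  shows "(\<lambda>\<phi>. max (f \<phi>) (g \<phi>)) \<in> limit_functions"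
proof (rule limit_functionsI)
  fix e :: real assume "0 < e"
  then obtain x y where x: "x \<in> E" "\<And>\<phi>. \<phi> \<in> characters \<Longrightarrow> \<bar>\<phi> x - f \<phi>\<bar> \<le> e"
    and y: "y \<in> E" "\<And>\<phi>. \<phi> \<in> characters \<Longrightarrow> \<bar>\<phi> y - g \<phi>\<bar> \<le> e"
    using limit_functions_approx[OF assms(1)] limit_functions_approx[OF assms(2)] by metis
  have "\<bar>eval_at (x + y) \<phi> - max (f \<phi>) (g \<phi>)\<bar> \<le> e" if "\<phi> \<in> characters" for \<phi>
    using x(2)[OF that] y(2)[OF that] unfolding eval_at_def if_P[OF that] char_add[OF that x(1) y(1)]
    by linarith
  then show "\<exists>h\<in>limit_functions. \<forall>\<phi>\<in>characters. \<bar>h \<phi> - max (f \<phi>) (g \<phi>)\<bar> \<le> e"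
    using eval_at_limit[OF E_add[OF x(1) y(1)]] by blast
qed (use assms in \<open>simp add: limit_functions_def\<close>)

lemma rational_scaling:
  assumes "f \<in> limit_functions" "0 < \<alpha>"
  shows "(\<lambda>\<phi>. real_of_rat \<alpha> * f \<phi>) \<in> limit_functions"
proof (rule limit_functionsI)
  fix e :: real assume "0 < e"
  have \<alpha>: "0 < real_of_rat \<alpha>" using assms by simp
  obtain x where x: "x \<in> E" "\<And>\<phi>. \<phi> \<in> characters \<Longrightarrow> \<bar>\<phi> x - f \<phi>\<bar> \<le> e / real_of_rat \<alpha>"
    using limit_functions_approx[OF assms(1)] \<open>0 < e\<close> \<alpha> by (metis divide_pos_pos)
  have "\<bar>eval_at (qpow \<alpha> x) \<phi> - real_of_rat \<alpha> * f \<phi>\<bar> \<le> e" if "\<phi> \<in> characters" for \<phi>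
  proof -
    have "real_of_rat \<alpha> * \<bar>\<phi> x - f \<phi>\<bar> \<le> e"
      using x(2)[OF that] \<alpha> by (simp add: pos_le_divide_eq mult.commute)
    moreover have "eval_at (qpow \<alpha> x) \<phi> - real_of_rat \<alpha> * f \<phi> = real_of_rat \<alpha> * (\<phi> x - f \<phi>)"
      using that char_qpow[OF that x(1) assms(2)] by (simp add: eval_at_def right_diff_distrib)
    ultimately show ?thesis using \<alpha> by (simp add: abs_mult)
  qed
  then show "\<exists>h\<in>limit_functions. \<forall>\<phi>\<in>characters. \<bar>h \<phi> - real_of_rat \<alpha> * f \<phi>\<bar> \<le> e"
    using eval_at_limit[OF E_qpow[OF x(1) assms(2)]] by blast
qed (use assms in \<open>simp add: limit_functions_def\<close>)

text \<open>Real factors are uniform limits of rational ones, as \<open>f\<close> is bounded.\<close>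
lemma limit_functions_scale:
  assumes f: "f \<in> limit_functions" and l: "0 < l"
  shows "(\<lambda>\<phi>. l * f \<phi>) \<in> limit_functions"
proof (rule limit_functionsI)
  fix e :: real assume "0 < e"
  obtain M where M: "0 \<le> M" "\<And>\<phi>. \<bar>f \<phi>\<bar> \<le> M" using limit_functions_bounded[OF f] by blast
  have "l < l + e / (M + 1)" using \<open>0 < e\<close> M(1) by simp
  then obtain q where q: "l < real_of_rat q" "real_of_rat q < l + e / (M + 1)"
    using of_rat_dense by blast
  have "\<bar>real_of_rat q * f \<phi> - l * f \<phi>\<bar> \<le> e" for \<phi>
  proof -
    have "\<bar>real_of_rat q * f \<phi> - l * f \<phi>\<bar> = (real_of_rat q - l) * \<bar>f \<phi>\<bar>"
      using q(1) by (simp add: abs_mult flip: left_diff_distrib)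
    also have "\<dots> \<le> e / (M + 1) * (M + 1)"
      using q M(1) M(2)[of \<phi>] by (intro Rings.mult_mono) auto
    also have "\<dots> = e" using M(1) by simp
    finally show ?thesis .
  qed
  moreover have "0 < real_of_rat q" using l q(1) by linarith
  then have "(\<lambda>\<phi>. real_of_rat q * f \<phi>) \<in> limit_functions" using rational_scaling[OF f] by simp
  ultimately show "\<exists>h\<in>limit_functions. \<forall>\<phi>\<in>characters. \<bar>h \<phi> - l * f \<phi>\<bar> \<le> e"
    by (intro bexI[of _ "\<lambda>\<phi>. real_of_rat q * f \<phi>"]) auto
qed (use f in \<open>simp add: limit_functions_def\<close>)

definition const_fn :: "real \<Rightarrow> ('a \<Rightarrow> real) \<Rightarrow> real" where
  "const_fn c \<phi> = (if \<phi> \<in> characters then c else 0)"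

lemma const_fn_eval: "const_fn 0 = eval_at 1" "const_fn 1 = eval_at \<rho>" "const_fn (-1) = eval_at rho_inv"
  by (auto simp: const_fn_def eval_at_def char_1 char_rho char_rho_inv)

lemma const_fn_scale: "const_fn (l * c) = (\<lambda>\<phi>. l * const_fn c \<phi>)"
  by (auto simp: const_fn_def)

text \<open>The nonzero constants are positive real multiples of the evaluations at \<open>\<rho>\<close> and at its inverse.\<close>
lemma const_fn_limit: "const_fn c \<in> limit_functions"
proof -
  consider "c = 0" | "0 < c" | "c < 0" by linarith
  then show ?thesis
  proof cases
    case 1 then show ?thesis using eval_at_limit[OF E_one] const_fn_eval by simp
  next
    case 2 then show ?thesis
      using limit_functions_scale[OF eval_at_limit[OF E_rho] 2] const_fn_scale[of c 1] const_fn_eval by simp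
  next
    case 3 then show ?thesis
      using limit_functions_scale[OF eval_at_limit[OF E_rho_inv], of "- c"] const_fn_scale[of "- c" "-1"]
        const_fn_eval by simp
  qed
qed

lemma limit_class_nonempty: assumes "f \<in> limit_functions" shows "limit_class f \<noteq> {}"
proof -
  have "\<exists>x. x \<in> E \<and> (\<forall>\<phi>\<in>characters. \<bar>\<phi> x - f \<phi>\<bar> \<le> 1 / real (Suc n))" for n
    using limit_functions_approx[OF assms, of "1 / real (Suc n)"] by (metis of_nat_0_less_iff zero_less_Suc zero_less_divide_1_iff)
  then obtain s where s: "\<And>n. s n \<in> E" "\<And>n \<phi>. \<phi> \<in> characters \<Longrightarrow> \<bar>\<phi> (s n) - f \<phi>\<bar> \<le> 1 / real (Suc n)"
    by metis
  have "uniform_limit characters (\<lambda>n \<phi>. \<phi> (s n)) f sequentially"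
  proof (rule uniform_limitI)
    fix e :: real assume "0 < e"
    then have "\<forall>\<^sub>F n in sequentially. 1 / real (Suc n) < e"
      using lim_inverse_n'[THEN LIMSEQ_Suc] by (rule order_tendstoD(2)[rotated])
    then show "\<forall>\<^sub>F n in sequentially. \<forall>\<phi>\<in>characters. dist (\<phi> (s n)) (f \<phi>) < e"
      unfolding dist_real_def by eventually_elim (use s(2) le_less_trans in blast)
  qed
  then show ?thesis using s(1) unfolding limit_class_def by blast
qed

lemma char_diff_le_pdist:
  assumes "\<phi> \<in> characters" "x \<in> E" "y \<in> E" shows "\<bar>\<phi> x - \<phi> y\<bar> \<le> pdist \<rho> x y"
  using pdist_le_iff[OF assms(2,3), of "pdist \<rho> x y"] assms(1) by simp

lemma pdist_nonneg: assumes "x \<in> E" "y \<in> E" shows "0 \<le> pdist \<rho> x y"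
proof -
  obtain \<phi> where "\<phi> \<in> characters" using characters_nonempty by blast
  from char_diff_le_pdist[OF this assms] show ?thesis by linarith
qed

lemma cauchy_seqs_iff:
  "s \<in> cauchy_seqs \<rho> \<longleftrightarrow> (\<forall>n. s n \<in> E) \<and> uniformly_Cauchy_on characters (\<lambda>n \<phi>. \<phi> (s n))"
proof -
  have "(\<forall>e>0. \<exists>N. \<forall>m\<ge>N. \<forall>n\<ge>N. pdist \<rho> (s m) (s n) < e) \<longleftrightarrow>
      uniformly_Cauchy_on characters (\<lambda>n \<phi>. \<phi> (s n))" (is "?L \<longleftrightarrow> ?R") if s: "\<And>n. s n \<in> E"
  proof
    assume L: ?L
    show ?R
    proof (rule uniformly_Cauchy_onI)
      fix e :: real assume "0 < e"
      then obtain N where N: "\<And>m n. m \<ge> N \<Longrightarrow> n \<ge> N \<Longrightarrow> pdist \<rho> (s m) (s n) < e" using L by blast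
      show "\<exists>M. \<forall>\<phi>\<in>characters. \<forall>m\<ge>M. \<forall>n\<ge>M. dist (\<phi> (s m)) (\<phi> (s n)) < e"
        unfolding dist_real_def
        by (intro exI[of _ N] ballI allI impI le_less_trans[OF char_diff_le_pdist N] s)
    qed
  next
    assume R: ?R
    show ?L
    proof (intro allI impI)
      fix e :: real assume "0 < e"
      then have "0 < e / 2" by simp
      then obtain N where N: "\<And>\<phi> m n. \<phi> \<in> characters \<Longrightarrow> m \<ge> N \<Longrightarrow> n \<ge> N \<Longrightarrow> dist (\<phi> (s m)) (\<phi> (s n)) < e / 2"
        using R unfolding uniformly_Cauchy_on_def by meson
      have "pdist \<rho> (s m) (s n) < e" if "N \<le> m" "N \<le> n" for m n
      proof -
        have "pdist \<rho> (s m) (s n) \<le> e / 2"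
          unfolding pdist_le_iff[OF s s] using N that by (auto simp: dist_real_def intro: less_imp_le)
        then show ?thesis using \<open>0 < e\<close> by simp
      qed
      then show "\<exists>N. \<forall>m\<ge>N. \<forall>n\<ge>N. pdist \<rho> (s m) (s n) < e" by blast
    qed
  qed
  then show ?thesis unfolding cauchy_seqs_def E_def[symmetric] by blast
qed

lemma pdist_tendsto_0_iff:
  assumes st: "\<And>n. s n \<in> E" "\<And>n. t n \<in> E"
  shows "(\<lambda>n. pdist \<rho> (s n) (t n)) \<longlonglongrightarrow> 0 \<longleftrightarrow>
    uniform_limit characters (\<lambda>n \<phi>. \<phi> (s n) - \<phi> (t n)) (\<lambda>_. 0) sequentially" (is "?L \<longleftrightarrow> ?R")
proof
  assume L: ?L
  show ?R
  proof (rule uniform_limitI)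
    fix e :: real assume "0 < e"
    then have "\<forall>\<^sub>F n in sequentially. pdist \<rho> (s n) (t n) < e" using L order_tendstoD(2) by blast
    then show "\<forall>\<^sub>F n in sequentially. \<forall>\<phi>\<in>characters. dist (\<phi> (s n) - \<phi> (t n)) 0 < e"
      by eventually_elim (use char_diff_le_pdist[OF _ st] in \<open>auto intro: le_less_trans\<close>)
  qed
next
  assume R: ?R
  show ?L
  proof (rule order_tendstoI)
    fix e :: real assume "0 < e"
    then have "0 < e / 2" by simp
    from uniform_limitD[OF R this] show "\<forall>\<^sub>F n in sequentially. pdist \<rho> (s n) (t n) < e"
    proof eventually_elim
      case (elim n)
      then have "pdist \<rho> (s n) (t n) \<le> e / 2"
        unfolding pdist_le_iff[OF st] by (auto intro: less_imp_le)
      then show ?case using \<open>0 < e\<close> by simp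
    qed
  next
    fix e :: real assume "e < 0"
    then show "\<forall>\<^sub>F n in sequentially. e < pdist \<rho> (s n) (t n)"
      using pdist_nonneg[OF st] by (intro always_eventually allI) (rule less_le_trans)
  qed
qed

lemma limit_class_cauchy: "s \<in> limit_class f \<Longrightarrow> s \<in> cauchy_seqs \<rho>"
  unfolding limit_class_def cauchy_seqs_iff
  by (auto intro!: uniformly_convergent_Cauchy simp: uniformly_convergent_on_def)

lemma cauchy_limit_class:
  assumes "s \<in> cauchy_seqs \<rho>" obtains f where "f \<in> limit_functions" "s \<in> limit_class f"
proof -
  obtain g where g: "uniform_limit characters (\<lambda>n \<phi>. \<phi> (s n)) g sequentially"
    using assms Cauchy_uniformly_convergent unfolding cauchy_seqs_iff uniformly_convergent_on_def by blast
  define f where "f \<phi> = (if \<phi> \<in> characters then g \<phi> else 0)" for \<phi>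
  have lim: "uniform_limit characters (\<lambda>n \<phi>. \<phi> (s n)) f sequentially"
    using g by (rule uniform_limit_cong'[THEN iffD1, rotated 2]) (auto simp: f_def)
  have s: "s n \<in> E" for n using assms cauchy_seqs_iff by blast
  have "f \<in> limit_functions" unfolding limit_functions_def
  proof (intro CollectI conjI allI impI)
    fix e :: real assume "0 < e"
    from eventually_happens'[OF _ uniform_limitD[OF lim this]]
    obtain n where "\<forall>\<phi>\<in>characters. dist (\<phi> (s n)) (f \<phi>) < e" by auto
    then show "\<exists>x\<in>E. \<forall>\<phi>\<in>characters. \<bar>\<phi> x - f \<phi>\<bar> \<le> e"
      using s by (intro bexI[of _ "s n"]) (auto simp: dist_real_def intro: less_imp_le)
  qed (simp add: f_def)
  then show thesis using that lim s unfolding limit_class_def by blast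
qed

text \<open>Being at distance tending to \<open>0\<close> means having the same uniform limit.\<close>
lemma limit_class_image: assumes "s \<in> limit_class f" shows "cauchy_rel \<rho> `` {s} = limit_class f"
proof (intro Set.set_eqI iffI)
  have s: "\<And>n. s n \<in> E" and sf: "uniform_limit characters (\<lambda>n \<phi>. \<phi> (s n)) f sequentially"
    using assms unfolding limit_class_def by auto
  {
    fix t assume "t \<in> cauchy_rel \<rho> `` {s}"
    then have t: "\<And>n. t n \<in> E" and "(\<lambda>n. pdist \<rho> (s n) (t n)) \<longlonglongrightarrow> 0"
      unfolding cauchy_rel_def cauchy_seqs_iff by auto
    then have "uniform_limit characters (\<lambda>n \<phi>. \<phi> (s n) - \<phi> (t n)) (\<lambda>_. 0) sequentially"
      using pdist_tendsto_0_iff[of s t] s t by simp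
    from uniform_limit_minus[OF sf this] show "t \<in> limit_class f" using t unfolding limit_class_def by simp
  next
    fix t assume t: "t \<in> limit_class f"
    then have tE: "\<And>n. t n \<in> E" and tf: "uniform_limit characters (\<lambda>n \<phi>. \<phi> (t n)) f sequentially"
      unfolding limit_class_def by auto
    from uniform_limit_minus[OF sf tf] have "(\<lambda>n. pdist \<rho> (s n) (t n)) \<longlonglongrightarrow> 0"
      unfolding pdist_tendsto_0_iff[OF s tE] by simp
    then show "t \<in> cauchy_rel \<rho> `` {s}"
      using limit_class_cauchy[OF assms] limit_class_cauchy[OF t] unfolding cauchy_rel_def by blast
  }
qed

lemma limit_class_unique:
  assumes "s \<in> limit_class f" "s \<in> limit_class g" "f \<in> limit_functions" "g \<in> limit_functions" shows "f = g"
proof (rule limit_functions_eqI[OF assms(3,4)])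
  fix \<phi> assume \<phi>: "\<phi> \<in> characters"
  have "(\<lambda>n. \<phi> (s n)) \<longlonglongrightarrow> f \<phi>" "(\<lambda>n. \<phi> (s n)) \<longlonglongrightarrow> g \<phi>"
    using assms(1,2) tendsto_uniform_limitI[OF _ \<phi>] unfolding limit_class_def by fastforce+
  then show "f \<phi> = g \<phi>" by (rule LIMSEQ_unique)
qed

lemma limit_class_inj: "f \<in> limit_functions \<Longrightarrow> g \<in> limit_functions \<Longrightarrow> limit_class f = limit_class g \<longleftrightarrow> f = g"
  using limit_class_unique limit_class_nonempty by blast

text \<open>Cauchy sequences in \<open>E\<close> are uniformly Cauchy sequences of evaluations, hence uniformly convergent;
  their classes are classified by the limits.\<close>
lemma completion_eq: "completion \<rho> = limit_class ` limit_functions"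
proof (intro Set.set_eqI iffI)
  fix P assume "P \<in> completion \<rho>"
  then obtain s where s: "s \<in> cauchy_seqs \<rho>" "P = cauchy_rel \<rho> `` {s}"
    unfolding completion_def by (elim quotientE)
  obtain f where "f \<in> limit_functions" "s \<in> limit_class f" by (rule cauchy_limit_class[OF s(1)])
  then show "P \<in> limit_class ` limit_functions" unfolding s(2) by (simp add: limit_class_image)
next
  fix P assume "P \<in> limit_class ` limit_functions"
  then obtain f where f: "f \<in> limit_functions" "P = limit_class f" by auto
  obtain s where s: "s \<in> limit_class f" using limit_class_nonempty[OF f(1)] by auto
  show "P \<in> completion \<rho>" unfolding completion_def f(2) limit_class_image[OF s, symmetric]
    by (rule quotientI[OF limit_class_cauchy[OF s]])
qed

lemma lift1_limit_class:
  assumes "f \<in> limit_functions" "\<And>s. s \<in> limit_class f \<Longrightarrow> (\<lambda>n. T (s n)) \<in> limit_class g"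
  shows "lift1 \<rho> T (limit_class f) = limit_class g"
  unfolding lift1_def using limit_class_nonempty[OF assms(1)] limit_class_image[OF assms(2)] by simp

lemma lift2_limit_class:
  assumes "f \<in> limit_functions" "g \<in> limit_functions"
    "\<And>s t. s \<in> limit_class f \<Longrightarrow> t \<in> limit_class g \<Longrightarrow> (\<lambda>n. T (s n) (t n)) \<in> limit_class h"
  shows "lift2 \<rho> T (limit_class f) (limit_class g) = limit_class h"
  unfolding lift2_def
  using limit_class_nonempty[OF assms(1)] limit_class_nonempty[OF assms(2)] limit_class_image[OF assms(3)] by simp

lemma lift_mult:
  assumes "f \<in> limit_functions" "g \<in> limit_functions"
  shows "lift2 \<rho> (*) (limit_class f) (limit_class g) = limit_class (\<lambda>\<phi>. f \<phi> + g \<phi>)"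
proof (rule lift2_limit_class[OF assms])
  fix s t assume "s \<in> limit_class f" "t \<in> limit_class g"
  then have E: "\<And>n. s n \<in> E" "\<And>n. t n \<in> E"
    and lim: "uniform_limit characters (\<lambda>n \<phi>. \<phi> (s n) + \<phi> (t n)) (\<lambda>\<phi>. f \<phi> + g \<phi>) sequentially"
    unfolding limit_class_def by (auto intro: uniform_limit_add)
  have "uniform_limit characters (\<lambda>n \<phi>. \<phi> (s n * t n)) (\<lambda>\<phi>. f \<phi> + g \<phi>) sequentially"
    using lim by (rule uniform_limit_cong'[THEN iffD1, rotated 2]) (auto simp: char_mult E)
  then show "(\<lambda>n. s n * t n) \<in> limit_class (\<lambda>\<phi>. f \<phi> + g \<phi>)" unfolding limit_class_def using E E_mult by blast
qed

lemma lift_add: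
  assumes "f \<in> limit_functions" "g \<in> limit_functions"
  shows "lift2 \<rho> (+) (limit_class f) (limit_class g) = limit_class (\<lambda>\<phi>. max (f \<phi>) (g \<phi>))"
proof (rule lift2_limit_class[OF assms])
  fix s t assume "s \<in> limit_class f" "t \<in> limit_class g"
  then have E: "\<And>n. s n \<in> E" "\<And>n. t n \<in> E"
    and lim: "uniform_limit characters (\<lambda>n \<phi>. max (\<phi> (s n)) (\<phi> (t n))) (\<lambda>\<phi>. max (f \<phi>) (g \<phi>)) sequentially"
    unfolding limit_class_def by (auto intro: uniform_limit_max)
  have "uniform_limit characters (\<lambda>n \<phi>. \<phi> (s n + t n)) (\<lambda>\<phi>. max (f \<phi>) (g \<phi>)) sequentially"
    using lim by (rule uniform_limit_cong'[THEN iffD1, rotated 2]) (auto simp: char_add E)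
  then show "(\<lambda>n. s n + t n) \<in> limit_class (\<lambda>\<phi>. max (f \<phi>) (g \<phi>))" unfolding limit_class_def using E E_add by blast
qed

lemma lift_qpow:
  assumes "f \<in> limit_functions" "0 < \<alpha>"
  shows "lift1 \<rho> (qpow \<alpha>) (limit_class f) = limit_class (\<lambda>\<phi>. real_of_rat \<alpha> * f \<phi>)"
proof (rule lift1_limit_class[OF assms(1)])
  fix s assume "s \<in> limit_class f"
  then have E: "\<And>n. s n \<in> E"
    and lim: "uniform_limit characters (\<lambda>n \<phi>. real_of_rat \<alpha> * \<phi> (s n)) (\<lambda>\<phi>. real_of_rat \<alpha> * f \<phi>) sequentially"
    unfolding limit_class_def by (auto intro: bounded_linear_uniform_limit_intros)
  have "uniform_limit characters (\<lambda>n \<phi>. \<phi> (qpow \<alpha> (s n))) (\<lambda>\<phi>. real_of_rat \<alpha> * f \<phi>) sequentially"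
    using lim by (rule uniform_limit_cong'[THEN iffD1, rotated 2]) (auto simp: char_qpow E assms)
  then show "(\<lambda>n. qpow \<alpha> (s n)) \<in> limit_class (\<lambda>\<phi>. real_of_rat \<alpha> * f \<phi>)"
    unfolding limit_class_def using E E_qpow assms by blast
qed

lemma of_R_eq: assumes "x \<in> E" shows "of_R \<rho> x = Some (limit_class (eval_at x))"
proof -
  have "(\<lambda>_. x) \<in> limit_class (eval_at x)"
    unfolding limit_class_def eval_at_def using assms by (auto intro!: uniform_limitI)
  then show ?thesis unfolding of_R_def using limit_class_image E_nonzero[OF assms] by simp
qed

text \<open>The sup distance of two uniformly convergent sequences of functions converges to the sup distance
  of the limits.\<close>
lemma cdist_le_iff:
  assumes f: "f \<in> limit_functions" and g: "g \<in> limit_functions"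
  shows "cdist \<rho> (limit_class f) (limit_class g) \<le> e \<longleftrightarrow> (\<forall>\<phi>\<in>characters. \<bar>f \<phi> - g \<phi>\<bar> \<le> e)"
proof -
  define d where "d = (SUP \<phi>\<in>characters. \<bar>f \<phi> - g \<phi>\<bar>)"
  obtain M N where MN: "\<And>\<phi>. \<bar>f \<phi>\<bar> \<le> M" "\<And>\<phi>. \<bar>g \<phi>\<bar> \<le> N"
    using limit_functions_bounded f g by metis
  have "\<bar>f \<phi> - g \<phi>\<bar> \<le> M + N" for \<phi> using MN[of \<phi>] by linarith
  then have bdd: "bdd_above ((\<lambda>\<phi>. \<bar>f \<phi> - g \<phi>\<bar>) ` characters)" by (rule bdd_aboveI2)
  have d: "d \<le> e \<longleftrightarrow> (\<forall>\<phi>\<in>characters. \<bar>f \<phi> - g \<phi>\<bar> \<le> e)" for e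
    unfolding d_def using cSUP_le_iff[OF characters_nonempty bdd] by simp
  have lim: "(\<lambda>n. pdist \<rho> (s n) (t n)) \<longlonglongrightarrow> d" if "s \<in> limit_class f" "t \<in> limit_class g" for s t
  proof -
    have E: "\<And>n. s n \<in> E" "\<And>n. t n \<in> E" using that unfolding limit_class_def by auto
    have s: "uniform_limit characters (\<lambda>n \<phi>. \<phi> (s n)) f sequentially"
      and t: "uniform_limit characters (\<lambda>n \<phi>. \<phi> (t n)) g sequentially"
      using that unfolding limit_class_def by auto
    show ?thesis
    proof (rule tendstoI)
      fix e :: real assume "0 < e"
      then have "0 < e / 4" by simp
      from uniform_limitD[OF s this] uniform_limitD[OF t this]
      show "\<forall>\<^sub>F n in sequentially. dist (pdist \<rho> (s n) (t n)) d < e"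
      proof eventually_elim
        case (elim n)
        let ?p = "pdist \<rho> (s n) (t n)"
        have p: "\<bar>\<phi> (s n) - \<phi> (t n)\<bar> \<le> ?p" if "\<phi> \<in> characters" for \<phi>
          by (rule char_diff_le_pdist[OF that E])
        have d': "\<bar>f \<phi> - g \<phi>\<bar> \<le> d" if "\<phi> \<in> characters" for \<phi>
          using d[of d] that by simp
        have close: "\<bar>\<phi> (s n) - f \<phi>\<bar> < e / 4" "\<bar>\<phi> (t n) - g \<phi>\<bar> < e / 4" if "\<phi> \<in> characters" for \<phi>
          using elim that by (auto simp: dist_real_def)
        have "?p \<le> d + e / 2" unfolding pdist_le_iff[OF E]
        proof
          fix \<phi> assume "\<phi> \<in> characters"
          from close[OF this] d'[OF this] show "\<bar>\<phi> (s n) - \<phi> (t n)\<bar> \<le> d + e / 2" by linarith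
        qed
        moreover have "d \<le> ?p + e / 2" unfolding d
        proof
          fix \<phi> assume "\<phi> \<in> characters"
          from close[OF this] p[OF this] show "\<bar>f \<phi> - g \<phi>\<bar> \<le> ?p + e / 2" by linarith
        qed
        ultimately show ?case using \<open>0 < e\<close> unfolding dist_real_def by linarith
      qed
    qed
  qed
  have "cdist \<rho> (limit_class f) (limit_class g) = d" unfolding cdist_def
  proof (rule the_equality)
    fix d' assume "\<forall>s\<in>limit_class f. \<forall>t\<in>limit_class g. (\<lambda>n. pdist \<rho> (s n) (t n)) \<longlonglongrightarrow> d'"
    then show "d' = d"
      using lim limit_class_nonempty[OF f] limit_class_nonempty[OF g] LIMSEQ_unique by (metis all_not_in_conv)
  qed (use lim in blast)
  then show ?thesis using d by simp
qed

lemma cdist_tendsto_0_iff: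
  assumes h: "\<forall>\<^sub>F n in sequentially. h n \<in> limit_functions" and g: "g \<in> limit_functions"
  shows "(\<lambda>n. cdist \<rho> (limit_class (h n)) (limit_class g)) \<longlonglongrightarrow> 0 \<longleftrightarrow> uniform_limit characters h g sequentially"
    (is "?L \<longleftrightarrow> ?R")
proof
  assume L: ?L
  show ?R
  proof (rule uniform_limitI)
    fix e :: real assume "0 < e"
    then have "\<forall>\<^sub>F n in sequentially. cdist \<rho> (limit_class (h n)) (limit_class g) < e" using L order_tendstoD(2) by blast
    with h show "\<forall>\<^sub>F n in sequentially. \<forall>\<phi>\<in>characters. dist (h n \<phi>) (g \<phi>) < e"
    proof eventually_elim
      case (elim n)
      show ?case unfolding dist_real_def
        using cdist_le_iff[OF elim(1) g, THEN iffD1, OF order_refl] elim(2) le_less_trans by blast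
    qed
  qed
next
  assume R: ?R
  show ?L
  proof (rule order_tendstoI)
    fix e :: real assume "0 < e"
    then have "0 < e / 2" by simp
    from h uniform_limitD[OF R this] show "\<forall>\<^sub>F n in sequentially. cdist \<rho> (limit_class (h n)) (limit_class g) < e"
    proof eventually_elim
      case (elim n)
      then have "cdist \<rho> (limit_class (h n)) (limit_class g) \<le> e / 2"
        unfolding cdist_le_iff[OF elim(1) g] by (auto simp: dist_real_def intro: less_imp_le)
      then show ?case using \<open>0 < e\<close> by simp
    qed
  next
    fix e :: real assume "e < 0"
    obtain \<phi> where \<phi>: "\<phi> \<in> characters" using characters_nonempty by blast
    from h show "\<forall>\<^sub>F n in sequentially. e < cdist \<rho> (limit_class (h n)) (limit_class g)"
    proof eventually_elim
      case (elim n)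
      from cdist_le_iff[OF elim g, THEN iffD1, OF order_refl] \<phi>
      have "\<bar>h n \<phi> - g \<phi>\<bar> \<le> cdist \<rho> (limit_class (h n)) (limit_class g)" by blast
      then show ?case using \<open>e < 0\<close> by linarith
    qed
  qed
qed

text \<open>A sequence with nonzero limit eventually leaves the isolated point \<open>0\<close>, and from there on its
  distance to the limit is a sup distance.\<close>
lemma converges_to_Some:
  assumes g: "g \<in> limit_functions"
  shows "converges_to \<rho> f (Some (limit_class g)) \<longleftrightarrow>
    (\<exists>h. (\<forall>\<^sub>F n in sequentially. h n \<in> limit_functions \<and> f n = Some (limit_class (h n))) \<and>
      uniform_limit characters h g sequentially)" (is "?L \<longleftrightarrow> ?R")
proof
  assume ?L
  then have ev: "\<forall>\<^sub>F n in sequentially. f n \<in> Some ` limit_class ` limit_functions"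
    and lim: "(\<lambda>n. cdist \<rho> (the (f n)) (limit_class g)) \<longlonglongrightarrow> 0"
    unfolding converges_to_def completion_eq by auto
  have "\<exists>g. f n \<in> Some ` limit_class ` limit_functions \<longrightarrow> g \<in> limit_functions \<and> f n = Some (limit_class g)" for n
    by auto
  then obtain h where h: "f n \<in> Some ` limit_class ` limit_functions \<Longrightarrow> h n \<in> limit_functions \<and> f n = Some (limit_class (h n))" for n
    by metis
  have ev': "\<forall>\<^sub>F n in sequentially. h n \<in> limit_functions \<and> f n = Some (limit_class (h n))"
    using ev by eventually_elim (rule h)
  have "(\<lambda>n. cdist \<rho> (limit_class (h n)) (limit_class g)) \<longlonglongrightarrow> 0"
    by (rule Lim_transform_eventually[OF lim]) (use ev' in eventually_elim, simp)
  then have "uniform_limit characters h g sequentially"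
    by (subst (asm) cdist_tendsto_0_iff[OF _ g]) (use ev' in \<open>auto elim: eventually_mono\<close>)
  then show ?R using ev' by blast
next
  assume ?R
  then obtain h where ev: "\<forall>\<^sub>F n in sequentially. h n \<in> limit_functions \<and> f n = Some (limit_class (h n))"
    and lim: "uniform_limit characters h g sequentially" by blast
  have "(\<lambda>n. cdist \<rho> (limit_class (h n)) (limit_class g)) \<longlonglongrightarrow> 0"
    by (subst cdist_tendsto_0_iff[OF _ g]) (use ev lim in \<open>auto elim: eventually_mono\<close>)
  then have "(\<lambda>n. cdist \<rho> (the (f n)) (limit_class g)) \<longlonglongrightarrow> 0"
    by (rule Lim_transform_eventually) (use ev in eventually_elim, simp)
  moreover have "\<forall>\<^sub>F n in sequentially. f n \<in> Some ` limit_class ` limit_functions"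
    using ev by eventually_elim auto
  ultimately show ?L unfolding converges_to_def completion_eq using g by auto
qed

lemma converges_to_unique:
  assumes y: "converges_to \<rho> f y" and z: "converges_to \<rho> f z" shows "y = z"
proof -
  have mixed: False if "converges_to \<rho> f None" "converges_to \<rho> f (Some P)" for P
  proof -
    from that have "\<forall>\<^sub>F n in sequentially. f n = None" "\<forall>\<^sub>F n in sequentially. f n \<in> Some ` completion \<rho>"
      unfolding converges_to_def by auto
    then have "\<forall>\<^sub>F n in sequentially. False" by eventually_elim auto
    then show False by simp
  qed
  have some: "P = Q" if P: "converges_to \<rho> f (Some P)" and Q: "converges_to \<rho> f (Some Q)" for P Q
  proof -
    have "P \<in> completion \<rho>" "Q \<in> completion \<rho>" using that unfolding converges_to_def by auto
    then obtain g g' where g: "g \<in> limit_functions" "P = limit_class g" and g': "g' \<in> limit_functions" "Q = limit_class g'"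
      unfolding completion_eq by blast
    obtain h where h: "\<forall>\<^sub>F n in sequentially. h n \<in> limit_functions \<and> f n = Some (limit_class (h n))"
      and hg: "uniform_limit characters h g sequentially"
      using P unfolding g(2) converges_to_Some[OF g(1)] by blast
    obtain h' where h': "\<forall>\<^sub>F n in sequentially. h' n \<in> limit_functions \<and> f n = Some (limit_class (h' n))"
      and hg': "uniform_limit characters h' g' sequentially"
      using Q unfolding g'(2) converges_to_Some[OF g'(1)] by blast
    have eq: "\<forall>\<^sub>F n in sequentially. h n = h' n"
      using h h' by eventually_elim (metis limit_class_inj option.inject)
    have "g \<phi> = g' \<phi>" if "\<phi> \<in> characters" for \<phi>
    proof (rule LIMSEQ_unique)
      show "(\<lambda>n. h n \<phi>) \<longlonglongrightarrow> g \<phi>" by (rule tendsto_uniform_limitI[OF hg that])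
      show "(\<lambda>n. h n \<phi>) \<longlonglongrightarrow> g' \<phi>"
        by (rule Lim_transform_eventually[OF tendsto_uniform_limitI[OF hg' that]])
          (use eq in \<open>auto elim: eventually_mono\<close>)
    qed
    then show ?thesis using limit_functions_eqI g g' by metis
  qed
  show ?thesis using y z mixed some by (cases y; cases z) auto
qed

section \<open>Operations of \<open>Rbar \<rho>\<close> on functions\<close>

lemma carrier_Rbar: "carrier (Rbar \<rho>) = insert None (Some ` limit_class ` limit_functions)"
  by (simp add: Rbar_def completion_eq)

lemma Some_limit_class_in_carrier [simp]: "f \<in> limit_functions \<Longrightarrow> Some (limit_class f) \<in> carrier (Rbar \<rho>)"
  and None_in_carrier [simp]: "None \<in> carrier (Rbar \<rho>)"
  by (simp_all add: carrier_Rbar)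

lemma carrier_cases:
  assumes "x \<in> carrier (Rbar \<rho>)"
  obtains "x = None" | f where "f \<in> limit_functions" "x = Some (limit_class f)"
  using assms unfolding carrier_Rbar by auto

lemma Rbar_mult_None [simp]:
  "None \<otimes>\<^bsub>Rbar \<rho>\<^esub> x = None" "x \<otimes>\<^bsub>Rbar \<rho>\<^esub> None = None"
  by (simp_all add: Rbar_def split: option.splits)

lemma Rbar_add_None [simp]:
  "None \<oplus>\<^bsub>Rbar \<rho>\<^esub> x = x" "x \<oplus>\<^bsub>Rbar \<rho>\<^esub> None = x"
  by (simp_all add: Rbar_def split: option.splits)

lemma Rbar_mult [simp]:
  "f \<in> limit_functions \<Longrightarrow> g \<in> limit_functions \<Longrightarrow>
    Some (limit_class f) \<otimes>\<^bsub>Rbar \<rho>\<^esub> Some (limit_class g) = Some (limit_class (\<lambda>\<phi>. f \<phi> + g \<phi>))"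
  by (simp add: Rbar_def lift_mult)

lemma Rbar_add [simp]:
  "f \<in> limit_functions \<Longrightarrow> g \<in> limit_functions \<Longrightarrow>
    Some (limit_class f) \<oplus>\<^bsub>Rbar \<rho>\<^esub> Some (limit_class g) = Some (limit_class (\<lambda>\<phi>. max (f \<phi>) (g \<phi>)))"
  by (simp add: Rbar_def lift_add)

lemma Rbar_zero: "\<zero>\<^bsub>Rbar \<rho>\<^esub> = None"
  by (simp add: Rbar_def)

lemma Rbar_one: "\<one>\<^bsub>Rbar \<rho>\<^esub> = Some (limit_class (const_fn 0))"
  by (simp add: Rbar_def of_R_eq[OF E_one] const_fn_eval)

lemma abelian_monoid_Rbar: "abelian_monoid (Rbar \<rho>)"
  by (rule abelian_monoidI)
    (auto elim!: carrier_cases simp: Rbar_zero limit_functions_max max.assoc max.commute max.left_commute)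

lemma finsum_Some:
  assumes "\<And>k. h k \<in> limit_functions"
  shows "(\<lambda>\<phi>. MAX k\<in>{0..n}. h k \<phi>) \<in> limit_functions"
    and "(\<Oplus>\<^bsub>Rbar \<rho>\<^esub>k\<in>{0..n::nat}. Some (limit_class (h k))) = Some (limit_class (\<lambda>\<phi>. MAX k\<in>{0..n}. h k \<phi>))"
proof -
  interpret R: abelian_monoid "Rbar \<rho>" by (rule abelian_monoid_Rbar)
  have "(\<lambda>\<phi>. MAX k\<in>{0..n}. h k \<phi>) \<in> limit_functions \<and>
    (\<Oplus>\<^bsub>Rbar \<rho>\<^esub>k\<in>{0..n::nat}. Some (limit_class (h k))) = Some (limit_class (\<lambda>\<phi>. MAX k\<in>{0..n}. h k \<phi>))"
  proof (induction n)
    case 0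
    show ?case using assms by (simp add: R.finsum_insert R.finsum_empty Rbar_zero)
  next
    case (Suc n)
    have "(\<lambda>\<phi>. MAX k\<in>{0..Suc n}. h k \<phi>) = (\<lambda>\<phi>. max (h (Suc n) \<phi>) (MAX k\<in>{0..n}. h k \<phi>))"
      by (simp add: atLeast0_atMost_Suc Max_insert)
    then show ?case
      using Suc assms limit_functions_max by (simp add: atLeast0_atMost_Suc R.finsum_insert)
  qed
  then show "(\<lambda>\<phi>. MAX k\<in>{0..n}. h k \<phi>) \<in> limit_functions"
    "(\<Oplus>\<^bsub>Rbar \<rho>\<^esub>k\<in>{0..n::nat}. Some (limit_class (h k))) = Some (limit_class (\<lambda>\<phi>. MAX k\<in>{0..n}. h k \<phi>))"
    by simp_all
qed

section \<open>Real powers\<close>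

lemma converges_to_const:
  assumes "y \<in> carrier (Rbar \<rho>)" "\<forall>\<^sub>F n in sequentially. f n = y"
  shows "converges_to \<rho> f y"
  using assms(1)
proof (cases rule: carrier_cases)
  case 1 then show ?thesis using assms(2) by (simp add: converges_to_def)
next
  case (2 g)
  show ?thesis unfolding 2(2) converges_to_Some[OF 2(1)]
    by (intro exI[of _ "\<lambda>_. g"] conjI uniform_limit_const) (use assms(2) 2 in simp)
qed

lemma rational_sequence:
  assumes "0 < l" obtains q where "\<And>n. 0 < q n" "(\<lambda>n::nat. real_of_rat (q n)) \<longlonglongrightarrow> l"
proof -
  have "\<exists>q. l < real_of_rat q \<and> real_of_rat q < l + 1 / real (Suc n)" for n
    using of_rat_dense[of l "l + 1 / real (Suc n)"] by auto
  then obtain q where q: "\<And>n. l < real_of_rat (q n)" "\<And>n. real_of_rat (q n) < l + 1 / real (Suc n)"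
    by metis
  have "(\<lambda>n. l + 1 / real (Suc n)) \<longlonglongrightarrow> l + 0"
    by (rule tendsto_add[OF tendsto_const LIMSEQ_Suc[OF lim_inverse_n']])
  then have lim: "(\<lambda>n. l + 1 / real (Suc n)) \<longlonglongrightarrow> l" by simp
  have "(\<lambda>n. real_of_rat (q n)) \<longlonglongrightarrow> l"
  proof (rule tendsto_sandwich[OF _ _ tendsto_const lim])
    show "\<forall>\<^sub>F n in sequentially. l \<le> real_of_rat (q n)"
      by (intro always_eventually allI less_imp_le q)
    show "\<forall>\<^sub>F n in sequentially. real_of_rat (q n) \<le> l + 1 / real (Suc n)"
      by (intro always_eventually allI less_imp_le q)
  qed
  moreover have "0 < q n" for n
  proof -
    have "0 < real_of_rat (q n)" using assms q(1)[of n] by linarith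
    then show ?thesis by simp
  qed
  ultimately show thesis using that by blast
qed

text \<open>Limits are unique, and the condition in \<open>theta\<close> is not vacuous, as a positive real is a limit of
  positive rationals.\<close>
lemma theta_eqI:
  assumes "0 < l" "\<And>q. (\<And>n. 0 < q n) \<Longrightarrow> (\<lambda>n. real_of_rat (q n)) \<longlonglongrightarrow> l \<Longrightarrow>
    converges_to \<rho> (\<lambda>n. qtheta \<rho> (q n) x) y"
  shows "theta \<rho> l x = y"
  unfolding theta_def
proof (rule the_equality)
  fix z assume z: "\<forall>q. (\<forall>n. 0 < q n) \<and> (\<lambda>n. real_of_rat (q n)) \<longlonglongrightarrow> l \<longrightarrow>
    converges_to \<rho> (\<lambda>n. qtheta \<rho> (q n) x) z"
  obtain q where "\<And>n. 0 < q n" "(\<lambda>n::nat. real_of_rat (q n)) \<longlonglongrightarrow> l"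
    using rational_sequence[OF assms(1)] by blast
  then show "z = y" using z assms(2)[of q] converges_to_unique by blast
qed (use assms(2) in blast)

lemma theta_None: "0 < l \<Longrightarrow> theta \<rho> l None = None"
  by (rule theta_eqI) (auto simp: qtheta_def converges_to_def)

lemma theta_Some:
  assumes f: "f \<in> limit_functions" and l: "0 < l"
  shows "theta \<rho> l (Some (limit_class f)) = Some (limit_class (\<lambda>\<phi>. l * f \<phi>))"
proof (rule theta_eqI[OF l])
  fix q :: "nat \<Rightarrow> rat" assume q: "\<And>n. 0 < q n" "(\<lambda>n. real_of_rat (q n)) \<longlonglongrightarrow> l"
  obtain M where M: "0 \<le> M" "\<And>\<phi>. \<bar>f \<phi>\<bar> \<le> M" using limit_functions_bounded[OF f] by blast
  have "uniform_limit characters (\<lambda>n \<phi>. real_of_rat (q n) * f \<phi>) (\<lambda>\<phi>. l * f \<phi>) sequentially"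
  proof (rule uniform_limitI)
    fix e :: real assume "0 < e"
    then have "0 < e / (M + 1)" using M(1) by simp
    from tendstoD[OF q(2) this]
    show "\<forall>\<^sub>F n in sequentially. \<forall>\<phi>\<in>characters. dist (real_of_rat (q n) * f \<phi>) (l * f \<phi>) < e"
    proof eventually_elim
      case (elim n)
      show ?case
      proof
        fix \<phi>
        have "dist (real_of_rat (q n) * f \<phi>) (l * f \<phi>) = dist (real_of_rat (q n)) l * \<bar>f \<phi>\<bar>"
          by (simp add: dist_real_def abs_mult flip: left_diff_distrib)
        also have "\<dots> \<le> dist (real_of_rat (q n)) l * (M + 1)"
          using M(2)[of \<phi>] by (intro mult_left_mono) auto
        also have "\<dots> < e" using elim M(1) by (simp add: pos_less_divide_eq)
        finally show "dist (real_of_rat (q n) * f \<phi>) (l * f \<phi>) < e" .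
      qed
    qed
  qed
  moreover have "qtheta \<rho> (q n) (Some (limit_class f)) = Some (limit_class (\<lambda>\<phi>. real_of_rat (q n) * f \<phi>))" for n
    by (simp add: qtheta_def lift_qpow f q)
  ultimately show "converges_to \<rho> (\<lambda>n. qtheta \<rho> (q n) (Some (limit_class f))) (Some (limit_class (\<lambda>\<phi>. l * f \<phi>)))"
    unfolding converges_to_Some[OF limit_functions_scale[OF f l]] using rational_scaling[OF f q(1)]
    by (intro exI[of _ "\<lambda>n \<phi>. real_of_rat (q n) * f \<phi>"]) auto
qed

lemma const_fn_add: "(\<lambda>\<phi>. const_fn a \<phi> + const_fn b \<phi>) = const_fn (a + b)"
  by (auto simp: const_fn_def)

lemma rho_pow_pos: "0 < l \<Longrightarrow> theta \<rho> l (of_R \<rho> \<rho>) = Some (limit_class (const_fn l))"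
  using theta_Some[OF const_fn_limit, of l 1] const_fn_scale[of l 1]
  by (simp add: of_R_eq[OF E_rho] const_fn_eval)

text \<open>In the function picture \<open>\<rho>\<close> is the constant \<open>1\<close>.\<close>
lemma rho_pow_eq: "rho_pow \<rho> l = Some (limit_class (const_fn l))"
proof -
  have "inv\<^bsub>Rbar \<rho>\<^esub> (Some (limit_class (const_fn (- l)))) = Some (limit_class (const_fn l))"
    unfolding m_inv_def
  proof (rule the_equality)
    fix y assume y: "y \<in> carrier (Rbar \<rho>) \<and>
      Some (limit_class (const_fn (- l))) \<otimes>\<^bsub>Rbar \<rho>\<^esub> y = \<one>\<^bsub>Rbar \<rho>\<^esub> \<and>
      y \<otimes>\<^bsub>Rbar \<rho>\<^esub> Some (limit_class (const_fn (- l))) = \<one>\<^bsub>Rbar \<rho>\<^esub>"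
    then have "y \<in> carrier (Rbar \<rho>)" by simp
    then show "y = Some (limit_class (const_fn l))"
    proof (cases rule: carrier_cases)
      case 1 then show ?thesis using y by (simp add: Rbar_one)
    next
      case (2 f)
      then have "limit_class (\<lambda>\<phi>. const_fn (- l) \<phi> + f \<phi>) = limit_class (const_fn 0)"
        using y by (simp add: Rbar_one const_fn_limit)
      then have eq: "(\<lambda>\<phi>. const_fn (- l) \<phi> + f \<phi>) = const_fn 0"
        by (subst (asm) limit_class_inj) (auto intro: limit_functions_add const_fn_limit 2)
      have "f = const_fn l"
      proof (rule limit_functions_eqI[OF 2(1) const_fn_limit])
        fix \<phi> assume "\<phi> \<in> characters"
        then show "f \<phi> = const_fn l \<phi>" using fun_cong[OF eq, of \<phi>] by (simp add: const_fn_def)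
      qed
      then show ?thesis using 2 by simp
    qed
  qed (simp add: const_fn_limit const_fn_add Rbar_one)
  then show ?thesis unfolding rho_pow_def using rho_pow_pos[of l] rho_pow_pos[of "- l"]
    by (cases "0 < l"; cases "l = 0") (simp_all add: Rbar_one)
qed

lemma w_eq: "w \<rho> a = Some (limit_class (const_fn (entropy_S a)))"
  by (simp add: w_def rho_pow_eq)

lemma const_fn_0 [simp]: "const_fn 0 \<phi> = 0"
  by (simp add: const_fn_def)

section \<open>The addition \<open>+\<^sub>w\<close>\<close>

lemma mix_Some:
  assumes "f \<in> limit_functions" "g \<in> limit_functions" "0 \<le> a" "a \<le> 1"
  shows "(\<lambda>\<phi>. a * f \<phi> + (1 - a) * g \<phi>) \<in> limit_functions"
    and "mix \<rho> a (Some (limit_class f)) (Some (limit_class g)) = Some (limit_class (\<lambda>\<phi>. a * f \<phi> + (1 - a) * g \<phi>))"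
proof -
  consider "a = 0" | "a = 1" | "0 < a" "0 < 1 - a" using assms(3,4) by linarith
  then have "(\<lambda>\<phi>. a * f \<phi> + (1 - a) * g \<phi>) \<in> limit_functions \<and>
    mix \<rho> a (Some (limit_class f)) (Some (limit_class g)) = Some (limit_class (\<lambda>\<phi>. a * f \<phi> + (1 - a) * g \<phi>))"
  proof cases
    case 3
    then show ?thesis using assms
      by (simp add: mix_def theta_Some limit_functions_scale limit_functions_add)
  qed (use assms in \<open>simp_all add: mix_def\<close>)
  then show "(\<lambda>\<phi>. a * f \<phi> + (1 - a) * g \<phi>) \<in> limit_functions"
    "mix \<rho> a (Some (limit_class f)) (Some (limit_class g)) = Some (limit_class (\<lambda>\<phi>. a * f \<phi> + (1 - a) * g \<phi>))" by blast+
qed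

text \<open>One summand of \<open>+\<^sub>w\<close> at the weight \<open>a\<close>, covering the endpoints \<open>0\<close> and \<open>1\<close> as well.\<close>
lemma weighted_mix_Some:
  assumes "f \<in> limit_functions" "g \<in> limit_functions" "0 \<le> a" "a \<le> 1"
  shows "w \<rho> a \<otimes>\<^bsub>Rbar \<rho>\<^esub> mix \<rho> a (Some (limit_class f)) (Some (limit_class g))
    = Some (limit_class (\<lambda>\<phi>. const_fn (entropy_S a) \<phi> + (a * f \<phi> + (1 - a) * g \<phi>)))"
  by (simp add: w_eq mix_Some assms const_fn_limit)

definition log_sum_exp :: "(('a \<Rightarrow> real) \<Rightarrow> real) \<Rightarrow> (('a \<Rightarrow> real) \<Rightarrow> real) \<Rightarrow> ('a \<Rightarrow> real) \<Rightarrow> real" where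
  "log_sum_exp f g \<phi> = (if \<phi> \<in> characters then ln (exp (f \<phi>) + exp (g \<phi>)) else 0)"

lemma wadd_eqI: "converges_to \<rho> (\<lambda>n. \<Oplus>\<^bsub>Rbar \<rho>\<^esub>k\<in>{0..n}. w \<rho> (real k / real n) \<otimes>\<^bsub>Rbar \<rho>\<^esub>
    mix \<rho> (real k / real n) x y) z \<Longrightarrow> wadd \<rho> x y = z"
  unfolding wadd_def by (rule the_equality) (auto intro: converges_to_unique)

text \<open>On functions \<open>+\<^sub>w\<close> is addition in logarithmic coordinates.  Since limit functions are bounded,
  \<open>grid_maximum_tends_to_log_sum_exp\<close> applies uniformly over all characters.\<close>
lemma wadd_Some:
  assumes f: "f \<in> limit_functions" and g: "g \<in> limit_functions"
  shows "log_sum_exp f g \<in> limit_functions"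
    and "wadd \<rho> (Some (limit_class f)) (Some (limit_class g)) = Some (limit_class (log_sum_exp f g))"
proof -
  define h where "h n k \<phi> = const_fn (entropy_S (real k / real n)) \<phi> +
    (real k / real n * f \<phi> + (1 - real k / real n) * g \<phi>)" for n k :: nat and \<phi>
  have ratio: "0 \<le> real k / real n" "real k / real n \<le> 1" if "k \<le> n" for k n :: nat
    using that by (auto simp: divide_le_eq)
  \<comment> \<open>\<open>finsum_Some\<close> needs a family of limit functions indexed by all of \<open>nat\<close>.\<close>
  define h' where "h' n k = (if k \<le> n then h n k else const_fn 0)" for n k
  have h': "h' n k \<in> limit_functions" for n k
    unfolding h'_def h_def
    using limit_functions_add[OF const_fn_limit mix_Some(1)[OF f g ratio]] const_fn_limit by simp
  have max: "(\<lambda>\<phi>. MAX k\<in>{0..n}. h n k \<phi>) = (\<lambda>\<phi>. MAX k\<in>{0..n}. h' n k \<phi>)" for n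
    unfolding h'_def by (auto intro!: arg_cong[of _ _ Max] image_cong)
  have mem: "(\<lambda>\<phi>. MAX k\<in>{0..n}. h n k \<phi>) \<in> limit_functions" for n
    unfolding max by (rule finsum_Some(1)[OF h'])
  have "w \<rho> (real k / real n) \<otimes>\<^bsub>Rbar \<rho>\<^esub> mix \<rho> (real k / real n) (Some (limit_class f)) (Some (limit_class g))
      = Some (limit_class (h' n k))" if "k \<in> {0..n}" for n k
  proof -
    have "k \<le> n" using that by simp
    then have "h' n k = (\<lambda>\<phi>. h n k \<phi>)" by (simp add: h'_def)
    then show ?thesis unfolding h_def using weighted_mix_Some[OF f g ratio[OF \<open>k \<le> n\<close>]] by simp
  qed
  then have sum: "(\<Oplus>\<^bsub>Rbar \<rho>\<^esub>k\<in>{0..n}. w \<rho> (real k / real n) \<otimes>\<^bsub>Rbar \<rho>\<^esub>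
      mix \<rho> (real k / real n) (Some (limit_class f)) (Some (limit_class g))) = Some (limit_class (\<lambda>\<phi>. MAX k\<in>{0..n}. h n k \<phi>))" for n
    unfolding max finsum_Some(2)[OF h', symmetric]
    by (intro abelian_monoid.finsum_cong'[OF abelian_monoid_Rbar]) (auto simp: h')
  obtain A B where AB: "0 \<le> A" "0 \<le> B" "\<And>\<phi>. \<bar>f \<phi>\<bar> \<le> A" "\<And>\<phi>. \<bar>g \<phi>\<bar> \<le> B"
    using limit_functions_bounded f g by metis
  have AB': "\<bar>f \<phi> - g \<phi>\<bar> \<le> A + B" for \<phi> using AB(3,4)[of \<phi>] by linarith
  have conv: "\<exists>N. \<forall>n\<ge>N. \<forall>\<phi>\<in>characters. \<bar>(MAX k\<in>{0..n}. h n k \<phi>) - log_sum_exp f g \<phi>\<bar> \<le> e"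
    if e: "0 < e" for e
  proof -
    obtain N where "\<And>n x y. N \<le> n \<Longrightarrow> \<bar>x - y\<bar> \<le> A + B \<Longrightarrow>
      \<bar>(MAX k\<in>{0..n}. entropy_S (real k / real n) + (real k / real n * x + (1 - real k / real n) * y))
        - ln (exp x + exp y)\<bar> \<le> e"
      using grid_maximum_tends_to_log_sum_exp[OF e, of "A + B"] AB(1,2) by auto
    then show ?thesis using AB'
      by (intro exI[of _ N]) (simp add: log_sum_exp_def h_def const_fn_def)
  qed
  show lse: "log_sum_exp f g \<in> limit_functions"
  proof (rule limit_functionsI)
    fix e :: real assume "0 < e"
    then show "\<exists>g'\<in>limit_functions. \<forall>\<phi>\<in>characters. \<bar>g' \<phi> - log_sum_exp f g \<phi>\<bar> \<le> e"
      using conv[of e] mem by (meson order_refl)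
  qed (simp add: log_sum_exp_def)
  have "uniform_limit characters (\<lambda>n \<phi>. MAX k\<in>{0..n}. h n k \<phi>) (log_sum_exp f g) sequentially"
    unfolding uniform_limit_sequentially_iff
  proof (intro allI impI)
    fix e :: real assume "0 < e"
    then obtain N where "\<forall>n\<ge>N. \<forall>\<phi>\<in>characters. \<bar>(MAX k\<in>{0..n}. h n k \<phi>) - log_sum_exp f g \<phi>\<bar> \<le> e / 2"
      using conv[of "e / 2"] by auto
    with \<open>0 < e\<close> show "\<exists>N. \<forall>n\<ge>N. \<forall>\<phi>\<in>characters. dist (MAX k\<in>{0..n}. h n k \<phi>) (log_sum_exp f g \<phi>) < e"
      by (intro exI[of _ N]) (fastforce simp: dist_real_def)
  qed
  then show "wadd \<rho> (Some (limit_class f)) (Some (limit_class g)) = Some (limit_class (log_sum_exp f g))"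
    by (intro wadd_eqI, unfold sum converges_to_Some[OF lse])
      (intro exI[of _ "\<lambda>n \<phi>. MAX k\<in>{0..n}. h n k \<phi>"] conjI, use mem in auto)
qed

lemma finsum_single:
  assumes "j \<in> {0..n::nat}" "y \<in> carrier (Rbar \<rho>)" "\<And>k. k \<in> {0..n} \<Longrightarrow> t k = (if j = k then y else None)"
  shows "(\<Oplus>\<^bsub>Rbar \<rho>\<^esub>k\<in>{0..n}. t k) = y"
proof -
  interpret R: abelian_monoid "Rbar \<rho>" by (rule abelian_monoid_Rbar)
  have "(\<Oplus>\<^bsub>Rbar \<rho>\<^esub>k\<in>{0..n}. t k) = (\<Oplus>\<^bsub>Rbar \<rho>\<^esub>k\<in>{0..n}. if j = k then y else \<zero>\<^bsub>Rbar \<rho>\<^esub>)"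
    by (intro R.finsum_cong') (use assms in \<open>auto simp: Rbar_zero\<close>)
  also have "\<dots> = y" using R.add.finprod_singleton[of j "{0..n}" "\<lambda>_. y"] assms(1,2) by simp
  finally show ?thesis .
qed

text \<open>With one argument \<open>0\<close> a single summand survives, at the end of the grid where the entropy vanishes.
  For \<open>n = 0\<close> the weight \<open>1\<close> is missing from the grid, hence the restriction to \<open>n > 0\<close>.\<close>
lemma wadd_None:
  assumes y: "y \<in> carrier (Rbar \<rho>)"
  shows "wadd \<rho> None y = y" "wadd \<rho> y None = y"
proof -
  have w0: "w \<rho> 0 \<otimes>\<^bsub>Rbar \<rho>\<^esub> y = y" and w1: "w \<rho> 1 \<otimes>\<^bsub>Rbar \<rho>\<^esub> y = y"
    using y by (cases rule: carrier_cases; simp add: w_eq entropy_S_def const_fn_limit)+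
  have "\<forall>\<^sub>F n in sequentially. (\<Oplus>\<^bsub>Rbar \<rho>\<^esub>k\<in>{0..n}. w \<rho> (real k / real n) \<otimes>\<^bsub>Rbar \<rho>\<^esub>
    mix \<rho> (real k / real n) None y) = y"
    using eventually_gt_at_top[of 0]
  proof eventually_elim
    case (elim n)
    show ?case by (rule finsum_single[of 0]) (use elim y w0 in \<open>auto simp: mix_def theta_None\<close>)
  qed
  then show "wadd \<rho> None y = y" by (intro wadd_eqI converges_to_const y)
  have "\<forall>\<^sub>F n in sequentially. (\<Oplus>\<^bsub>Rbar \<rho>\<^esub>k\<in>{0..n}. w \<rho> (real k / real n) \<otimes>\<^bsub>Rbar \<rho>\<^esub>
    mix \<rho> (real k / real n) y None) = y"
    using eventually_gt_at_top[of 0]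
  proof eventually_elim
    case (elim n)
    show ?case by (rule finsum_single[of n]) (use elim y w1 in \<open>auto simp: mix_def theta_None\<close>)
  qed
  then show "wadd \<rho> y None = y" by (intro wadd_eqI converges_to_const y)
qed

section \<open>The semi-ring \<open>Rbar_w \<rho>\<close> and its real scalars\<close>

lemma Rbar_w_simps [simp]:
  "carrier (Rbar_w \<rho>) = carrier (Rbar \<rho>)" "x \<otimes>\<^bsub>Rbar_w \<rho>\<^esub> y = x \<otimes>\<^bsub>Rbar \<rho>\<^esub> y"
  "\<one>\<^bsub>Rbar_w \<rho>\<^esub> = \<one>\<^bsub>Rbar \<rho>\<^esub>" "\<zero>\<^bsub>Rbar_w \<rho>\<^esub> = None" "x \<oplus>\<^bsub>Rbar_w \<rho>\<^esub> y = wadd \<rho> x y"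
  by (simp_all add: Rbar_w_def Rbar_zero)

lemma exp_log_sum_exp: "\<phi> \<in> characters \<Longrightarrow> exp (log_sum_exp f g \<phi>) = exp (f \<phi>) + exp (g \<phi>)"
  by (simp add: log_sum_exp_def add_pos_pos)

lemma log_sum_exp_commute: "log_sum_exp f g = log_sum_exp g f"
  by (auto simp: log_sum_exp_def add.commute)

text \<open>After applying \<open>exp\<close> this is associativity of the addition of real numbers.\<close>
lemma log_sum_exp_assoc: "log_sum_exp (log_sum_exp f g) h = log_sum_exp f (log_sum_exp g h)"
proof
  fix \<phi> show "log_sum_exp (log_sum_exp f g) h \<phi> = log_sum_exp f (log_sum_exp g h) \<phi>"
    using exp_log_sum_exp[of \<phi>] by (simp add: log_sum_exp_def[of _ _ \<phi>] add.assoc)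
qed

lemma log_sum_exp_distrib:
  assumes "h \<in> limit_functions"
  shows "(\<lambda>\<phi>. log_sum_exp f g \<phi> + h \<phi>) = log_sum_exp (\<lambda>\<phi>. f \<phi> + h \<phi>) (\<lambda>\<phi>. g \<phi> + h \<phi>)"
proof
  fix \<phi>
  have "ln ((exp (f \<phi>) + exp (g \<phi>)) * exp (h \<phi>)) = ln (exp (f \<phi>) + exp (g \<phi>)) + h \<phi>"
    using add_pos_pos[OF exp_gt_zero[of "f \<phi>"] exp_gt_zero[of "g \<phi>"]] by (simp add: ln_mult)
  then show "log_sum_exp f g \<phi> + h \<phi> = log_sum_exp (\<lambda>\<phi>. f \<phi> + h \<phi>) (\<lambda>\<phi>. g \<phi> + h \<phi>) \<phi>"
    using assms by (simp add: log_sum_exp_def exp_add distrib_right limit_functions_def)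
qed

lemma Rbar_mult_commute: "x \<in> carrier (Rbar \<rho>) \<Longrightarrow> y \<in> carrier (Rbar \<rho>) \<Longrightarrow>
    x \<otimes>\<^bsub>Rbar \<rho>\<^esub> y = y \<otimes>\<^bsub>Rbar \<rho>\<^esub> x"
  by (auto elim!: carrier_cases simp: add.commute)

lemma wadd_closed: "x \<in> carrier (Rbar \<rho>) \<Longrightarrow> y \<in> carrier (Rbar \<rho>) \<Longrightarrow> wadd \<rho> x y \<in> carrier (Rbar \<rho>)"
  by (auto elim!: carrier_cases simp: wadd_None wadd_Some)

lemma Rbar_mult_closed: "x \<in> carrier (Rbar \<rho>) \<Longrightarrow> y \<in> carrier (Rbar \<rho>) \<Longrightarrow> x \<otimes>\<^bsub>Rbar \<rho>\<^esub> y \<in> carrier (Rbar \<rho>)"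
  by (auto elim!: carrier_cases simp: limit_functions_add)

lemma wadd_distrib:
  assumes "x \<in> carrier (Rbar \<rho>)" "y \<in> carrier (Rbar \<rho>)" "z \<in> carrier (Rbar \<rho>)"
  shows "wadd \<rho> x y \<otimes>\<^bsub>Rbar \<rho>\<^esub> z = wadd \<rho> (x \<otimes>\<^bsub>Rbar \<rho>\<^esub> z) (y \<otimes>\<^bsub>Rbar \<rho>\<^esub> z)"
  using assms
  by (auto elim!: carrier_cases simp: wadd_None wadd_Some limit_functions_add log_sum_exp_distrib)

lemma semiring_Rbar_w: "semiring (Rbar_w \<rho>)"
proof (intro semiring.intro semiring_axioms.intro)
  show "abelian_monoid (Rbar_w \<rho>)"
  proof (rule abelian_monoidI)
    fix x y z assume "x \<in> carrier (Rbar_w \<rho>)" "y \<in> carrier (Rbar_w \<rho>)" "z \<in> carrier (Rbar_w \<rho>)"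
    then show "x \<oplus>\<^bsub>Rbar_w \<rho>\<^esub> y \<oplus>\<^bsub>Rbar_w \<rho>\<^esub> z = x \<oplus>\<^bsub>Rbar_w \<rho>\<^esub> (y \<oplus>\<^bsub>Rbar_w \<rho>\<^esub> z)"
      by (auto elim!: carrier_cases simp: wadd_None wadd_Some log_sum_exp_assoc)
  next
    fix x y assume "x \<in> carrier (Rbar_w \<rho>)" "y \<in> carrier (Rbar_w \<rho>)"
    then show "x \<oplus>\<^bsub>Rbar_w \<rho>\<^esub> y = y \<oplus>\<^bsub>Rbar_w \<rho>\<^esub> x"
      by (auto elim!: carrier_cases simp: wadd_None wadd_Some log_sum_exp_commute)
  qed (simp_all add: wadd_None wadd_closed)
  show "Group.monoid (Rbar_w \<rho>)"
  proof (rule monoidI)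
    fix x assume "x \<in> carrier (Rbar_w \<rho>)"
    then have "\<one>\<^bsub>Rbar \<rho>\<^esub> \<otimes>\<^bsub>Rbar \<rho>\<^esub> x = x"
      by (auto elim!: carrier_cases simp: Rbar_one const_fn_limit)
    moreover note Rbar_mult_commute[of "\<one>\<^bsub>Rbar \<rho>\<^esub>" x]
    ultimately show "\<one>\<^bsub>Rbar_w \<rho>\<^esub> \<otimes>\<^bsub>Rbar_w \<rho>\<^esub> x = x" "x \<otimes>\<^bsub>Rbar_w \<rho>\<^esub> \<one>\<^bsub>Rbar_w \<rho>\<^esub> = x"
      using \<open>x \<in> carrier (Rbar_w \<rho>)\<close> by (simp_all add: Rbar_one const_fn_limit)
  next
    fix x y z assume "x \<in> carrier (Rbar_w \<rho>)" "y \<in> carrier (Rbar_w \<rho>)" "z \<in> carrier (Rbar_w \<rho>)"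
    then show "x \<otimes>\<^bsub>Rbar_w \<rho>\<^esub> y \<otimes>\<^bsub>Rbar_w \<rho>\<^esub> z = x \<otimes>\<^bsub>Rbar_w \<rho>\<^esub> (y \<otimes>\<^bsub>Rbar_w \<rho>\<^esub> z)"
      by (auto elim!: carrier_cases simp: limit_functions_add add.assoc)
  qed (simp_all add: Rbar_mult_closed Rbar_one const_fn_limit)
next
  fix x y z assume "x \<in> carrier (Rbar_w \<rho>)" "y \<in> carrier (Rbar_w \<rho>)" "z \<in> carrier (Rbar_w \<rho>)"
  then show "(x \<oplus>\<^bsub>Rbar_w \<rho>\<^esub> y) \<otimes>\<^bsub>Rbar_w \<rho>\<^esub> z = x \<otimes>\<^bsub>Rbar_w \<rho>\<^esub> z \<oplus>\<^bsub>Rbar_w \<rho>\<^esub> y \<otimes>\<^bsub>Rbar_w \<rho>\<^esub> z"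
    "z \<otimes>\<^bsub>Rbar_w \<rho>\<^esub> (x \<oplus>\<^bsub>Rbar_w \<rho>\<^esub> y) = z \<otimes>\<^bsub>Rbar_w \<rho>\<^esub> x \<oplus>\<^bsub>Rbar_w \<rho>\<^esub> z \<otimes>\<^bsub>Rbar_w \<rho>\<^esub> y"
    using wadd_distrib[of x y z] Rbar_mult_commute[of z] wadd_closed[of x y] by simp_all
qed simp_all

text \<open>The nonnegative reals inside \<open>Rbar_w \<rho>\<close>: the number \<open>s\<close> has logarithmic coordinate \<open>ln s\<close>,
  and \<open>0\<close> is the adjoined zero.\<close>
definition real_scalar :: "real \<Rightarrow> 'a compl0" where
  "real_scalar s = (if s = 0 then None else rho_pow \<rho> (ln s))"

lemma real_scalar_add:
  assumes "0 \<le> s" "0 \<le> t" shows "real_scalar (s + t) = wadd \<rho> (real_scalar s) (real_scalar t)"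
proof -
  have "log_sum_exp (const_fn (ln s)) (const_fn (ln t)) = const_fn (ln (s + t))" if "0 < s" "0 < t"
    using that by (auto simp: log_sum_exp_def const_fn_def)
  then show ?thesis using assms
    by (auto simp: real_scalar_def rho_pow_eq wadd_None wadd_Some const_fn_limit)
qed

lemma real_scalar_mult:
  assumes "0 \<le> s" "0 \<le> t" shows "real_scalar (s * t) = real_scalar s \<otimes>\<^bsub>Rbar \<rho>\<^esub> real_scalar t"
  using assms by (auto simp: real_scalar_def rho_pow_eq const_fn_limit const_fn_add ln_mult)

interpretation w_semiring: commutative_semiring "Rbar_w \<rho>"
  by (intro commutative_semiring.intro semiring_Rbar_w commutative_semiring_axioms.intro)
    (simp add: Rbar_mult_commute)

lemma cring_W: "cring (W \<rho>)"
  unfolding W_def by (rule w_semiring.symmetrization_cring)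

lemma W_struct_eq:
  "W_struct \<rho> s = sym_class (Rbar_w \<rho>) (real_scalar (max s 0), real_scalar (max (- s) 0))"
  by (simp add: W_struct_def real_scalar_def W_def w_semiring.sym_zero)

lemma W_struct_hom: "W_struct \<rho> \<in> ring_hom (ring_of_type_algebra :: real ring) (W \<rho>)"
  unfolding W_def W_struct_eq[abs_def]
  by (rule w_semiring.symmetrization_hom)
    (auto simp: real_scalar_add real_scalar_mult, auto simp: real_scalar_def rho_pow_eq Rbar_one const_fn_limit)

end

theorem theorem6p11:
  fixes \<rho> :: "'a::comm_semiring_1"
  assumes char_one: "(1::'a) + 1 = 1"
    and cancellative: "\<And>x y z :: 'a. x \<noteq> 0 \<Longrightarrow> x * y = x * z \<Longrightarrow> y = z"
    and perfect: "\<And>n::nat. 1 \<le> n \<Longrightarrow> surj (\<lambda>x::'a. x ^ n)"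
    and rho_unit: "\<rho> dvd 1"
    and rho_ge_1: "1 \<preceq> \<rho>"
    and rho_neq_1: "\<rho> \<noteq> 1"
  shows "cring (W \<rho>)
       \<and> W_struct \<rho> \<in> ring_hom (ring_of_type_algebra :: real ring) (W \<rho>)
       \<and> algebra (ring_of_type_algebra :: real ring) (W_alg \<rho>)"
proof -
  interpret perfect_semiring \<rho>
    by (unfold_locales) (fact assms)+
  show ?thesis
    unfolding W_alg_def
    using cring_W W_struct_hom algebra_of_ring_hom[OF cring_from_type_algebra cring_W W_struct_hom] by blast
qed

end
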